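(* Let $d$ be a positive integer such that a SIC exists in dimension $d$, and let $\Phi_{\rm SIC}$ be the matrix associated with a SIC reference process in dimension $d$. Let $\{H_i\}_{i=1}^{d^2}$ be a MIC in dimension $d$, let $\{\sigma_j\}_{j=1}^{d^2}$ be a linearly independent set of density operators on $\mathbb{C}^d$ (post-measurement states), and let $\Phi$ be the $d^2\times d^2$ column-quasistochastic matrix associated with this arbitrary reference process, defined by $[\Phi^{-1}]_{ij}=\operatorname{tr}(H_i\sigma_j)$. Then $$|\det\Phi|\geq\det\Phi_{\rm SIC}$$ and $$s(\Phi)\succ_{w\log}s(\Phi_{\rm SIC}),$$ with equality (i.e. $|\det\Phi|=\det\Phi_{\rm SIC}$ in the first relation, respectively $s(\Phi)=s(\Phi_{\rm SIC})$ in the second) if and only if the MIC $\{H_i\}$ and the post-measurement states $\{\sigma_j\}$ are SICs (not necessarily the same SIC). In that case, $$\Phi^\dagger\Phi=\Phi\Phi^\dagger=\Phi_{\rm SIC}^2 .$$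
   Context: A MIC (minimal informationally complete POVM) in dimension $d$ is a family $\{H_i\}_{i=1}^{d^2}$ of positive semidefinite operators on $\mathbb{C}^d$ with $\sum_i H_i=I$ that is a basis of the real vector space of Hermitian operators on $\mathbb{C}^d$. A density operator is a positive semidefinite operator of trace $1$. A reference process consists of a MIC $\{H_i\}$ together with a linearly independent set of $d^2$ density operators $\{\sigma_j\}$ (the state $\sigma_i$ is prepared upon obtaining outcome $i$ of the MIC). The linear independence of $\{H_i\}$ and $\{\sigma_j\}$ guarantees that the matrix $[\operatorname{tr} H_i\sigma_j]_{ij}$ is invertible, so $\Phi$ (its inverse) is well defined. A real matrix is column-quasistochastic if each of its columns sums to $1$. A SIC in dimension $d$ is a MIC $\{H_i\}_{i=1}^{d^2}$ for which every $H_i$ has rank $1$ and $\operatorname{tr} H_iH_j=\frac{1}{d^2}\,\frac{d\,\delta_{ij}+1}{d+1}$ for all $i,j$. A set of states $\{\sigma_j\}_{j=1}^{d^2}$ is called a SIC if $\{\sigma_j/d\}$ is a SIC in this sense (so the $\sigma_j$ are rank-1 SIC projectors). SICs have not been proven to exist in all finite dimensions. $\Phi_{\rm SIC}$ denotes the matrix $\Phi$ of the reference process in which $\{H_i\}$ is a SIC and $\sigma_i=dH_i$ for all $i$ (measurement and post-measurement states are the same SIC). It does not depend on the choice of SIC: $[\Phi_{\rm SIC}]_{ij}=(d+1)\delta_{ij}-\frac1d$. $s(A)$ denotes the vector of singular values of the matrix $A$ in nonincreasing order. For vectors $x,y$ of $N$ real numbers (here, singular values), with $x^\downarrow,y^\downarrow$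 their rearrangements in nonincreasing order, $x\succ_{w\log}y$ ($x$ weakly log majorizes $y$ from below) means $\prod_{i=1}^k x_i^\downarrow\geq\prod_{i=1}^k y_i^\downarrow$ for all $k=1,\dots,N$. *)

theory Defs
  imports "HOL-Analysis.Analysis" "HOL-Computational_Algebra.Polynomial"
begin

text \<open>
  Operators on \<open>d\<close>-dimensional complex space are matrices of type \<open>complex^'d^'d\<close> with
  \<open>d = CARD('d)\<close>.  Families of \<open>d\<^sup>2\<close> operators are indexed by a finite type \<open>'m\<close>; the
  predicates below require \<open>CARD('m) = CARD('d)\<^sup>2\<close>.  The unqualified \<open>independent\<close> and
  \<open>span\<close> are those of real vector spaces.
\<close>

definition conj_transpose :: "complex^'n^'n \<Rightarrow> complex^'n^'n" where
  "conj_transpose A = (\<chi> i j. cnj (A $ j $ i))"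

definition hermitian :: "complex^'n^'n \<Rightarrow> bool" where
  "hermitian A \<longleftrightarrow> conj_transpose A = A"

definition pos_semidef :: "complex^'n^'n \<Rightarrow> bool" where
  "pos_semidef A \<longleftrightarrow>
     hermitian A \<and> (\<forall>v::complex^'n. 0 \<le> Re (\<Sum>i\<in>UNIV. cnj (v $ i) * (A *v v) $ i))"

definition density_operator :: "complex^'n^'n \<Rightarrow> bool" where
  "density_operator A \<longleftrightarrow> pos_semidef A \<and> trace A = 1"

definition MIC :: "('m::finite \<Rightarrow> complex^'d^'d) \<Rightarrow> bool" where
  "MIC H \<longleftrightarrow>
     CARD('m) = CARD('d)\<^sup>2 \<and>
     (\<forall>i. pos_semidef (H i)) \<and>
     (\<Sum>i\<in>UNIV. H i) = mat 1 \<and>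
     inj H \<and> independent (range H) \<and> span (range H) = {A. hermitian A}"

definition SIC :: "('m::finite \<Rightarrow> complex^'d^'d) \<Rightarrow> bool" where
  "SIC H \<longleftrightarrow>
     MIC H \<and>
     (\<forall>i. rank (H i) = 1) \<and>
     (\<forall>i j. trace (H i ** H j) =
        1 / of_nat (CARD('d)\<^sup>2) *
        ((of_nat CARD('d) * (if i = j then 1 else 0) + 1) / (of_nat CARD('d) + 1)))"

definition SIC_states :: "('m::finite \<Rightarrow> complex^'d^'d) \<Rightarrow> bool" where
  "SIC_states \<sigma> \<longleftrightarrow> SIC (\<lambda>j. (1 / real CARD('d)) *\<^sub>R \<sigma> j)"

definition reference_process ::
    "('m::finite \<Rightarrow> complex^'d^'d) \<Rightarrow> ('m \<Rightarrow> complex^'d^'d) \<Rightarrow> bool" where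
  "reference_process H \<sigma> \<longleftrightarrow>
     MIC H \<and> (\<forall>j. density_operator (\<sigma> j)) \<and> inj \<sigma> \<and> independent (range \<sigma>)"

text \<open>The traces in the next definition are real, since all operators involved are Hermitian.\<close>

definition outcome_matrix ::
    "('m::finite \<Rightarrow> complex^'d^'d) \<Rightarrow> ('m \<Rightarrow> complex^'d^'d) \<Rightarrow> real^'m^'m" where
  "outcome_matrix H \<sigma> = (\<chi> i j. Re (trace (H i ** \<sigma> j)))"

definition born_matrix ::
    "('m::finite \<Rightarrow> complex^'d^'d) \<Rightarrow> ('m \<Rightarrow> complex^'d^'d) \<Rightarrow> real^'m^'m" where
  "born_matrix H \<sigma> = matrix_inv (outcome_matrix H \<sigma>)"

definition column_quasistochastic :: "real^'m^'m \<Rightarrow> bool" where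
  "column_quasistochastic A \<longleftrightarrow> (\<forall>j. (\<Sum>i\<in>UNIV. A $ i $ j) = 1)"

definition char_polynomial :: "real^'m^'m \<Rightarrow> real poly" where
  "char_polynomial A = det (mat [:0, 1:] - map_matrix (\<lambda>x. [:x:]) A)"

text \<open>
  The matrix \<open>transpose A ** A\<close> is real symmetric, so all \<open>CARD('m)\<close> eigenvalues are found
  among the real roots of its characteristic polynomial; \<open>proots\<close> counts multiplicities.
\<close>

definition singular_values :: "real^'m^'m \<Rightarrow> real list" where
  "singular_values A =
     rev (sorted_list_of_multiset (image_mset sqrt (proots (char_polynomial (transpose A ** A)))))"

definition decreasing :: "real list \<Rightarrow> real list" where
  "decreasing xs = rev (sort xs)"

definition weakly_log_majorizes :: "real list \<Rightarrow> real list \<Rightarrow> bool" where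
  "weakly_log_majorizes xs ys \<longleftrightarrow>
     length xs = length ys \<and>
     (\<forall>k\<in>{1..length xs}. prod_list (take k (decreasing xs)) \<ge> prod_list (take k (decreasing ys)))"

lemma trace_mult_cmul_sum:
  fixes A :: "complex^'d^'d" and B :: "'m::finite \<Rightarrow> complex^'d^'d"
  shows "Re (trace (A ** (\<Sum>j\<in>UNIV. c j *\<^sub>R B j))) = (\<Sum>j\<in>UNIV. c j * Re (trace (A ** B j)))"
proof -
  have lin: "linear (\<lambda>X. Re (trace (A ** X)))"
    by (rule linearI)
       (simp_all add: trace_def matrix_matrix_mult_def algebra_simps sum.distrib
          sum_distrib_left sum_distrib_right)
  show ?thesis
    by (simp add: linear_sum[OF lin] linear_cmul[OF lin])
qed

lemma trace_square_hermitian_eq_0: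
  fixes X :: "complex^'d^'d"
  assumes "hermitian X" and "Re (trace (X ** X)) = 0"
  shows "X = 0"
proof -
  have c: "X $ j $ i = cnj (X $ i $ j)" for i j
    using assms(1) unfolding hermitian_def conj_transpose_def
    by (metis vec_lambda_beta)
  have "trace (X ** X) = (\<Sum>i\<in>UNIV. \<Sum>j\<in>UNIV. X $ i $ j * cnj (X $ i $ j))"
    unfolding trace_def matrix_matrix_mult_def by (simp add: c[symmetric])
  then have "Re (trace (X ** X)) = (\<Sum>i\<in>UNIV. \<Sum>j\<in>UNIV. (cmod (X $ i $ j))\<^sup>2)"
    by (simp only: Re_sum complex_norm_square[symmetric] Re_complex_of_real)
  then have "(\<Sum>i\<in>UNIV. \<Sum>j\<in>UNIV. (cmod (X $ i $ j))\<^sup>2) = 0"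
    using assms(2) by simp
  then have "\<forall>i j. (cmod (X $ i $ j))\<^sup>2 = 0"
    by (simp add: sum_nonneg_eq_0_iff sum_nonneg)
  then show ?thesis by (simp add: vec_eq_iff)
qed

lemma invertible_outcome_matrix:
  assumes "reference_process H \<sigma>"
  shows "invertible (outcome_matrix H \<sigma>)"
proof -
  have "c = 0" if c: "outcome_matrix H \<sigma> *v c = 0" for c
  proof -
    define X where "X = (\<Sum>j\<in>UNIV. (c $ j) *\<^sub>R \<sigma> j)"
    have herm: "hermitian (\<sigma> j)" for j
      using assms by (simp add: reference_process_def density_operator_def pos_semidef_def)
    have sp: "span (range H) = {A. hermitian A}"
      using assms by (simp add: reference_process_def MIC_def)
    have "X \<in> span (range H)"
      unfolding X_def by (intro span_sum span_scale) (simp add: sp herm)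
    then have hX: "hermitian X" by (simp add: sp)
    have HX: "Re (trace (H i ** X)) = 0" for i
      using c unfolding X_def trace_mult_cmul_sum
      by (simp add: vec_eq_iff matrix_vector_mult_def outcome_matrix_def mult.commute)
    have lin: "linear (\<lambda>Y. Re (trace (Y ** X)))"
      by (rule linearI)
         (simp_all add: trace_def matrix_matrix_mult_def algebra_simps sum.distrib
            sum_distrib_left sum_distrib_right)
    have "Re (trace (X ** X)) = 0"
      using linear_eq_0_on_span[OF lin _ \<open>X \<in> span (range H)\<close>] HX by auto
    then have "X = 0" by (rule trace_square_hermitian_eq_0[OF hX])
    have inj: "inj \<sigma>" and ind: "independent (range \<sigma>)"
      using assms by (auto simp: reference_process_def)
    have "(\<Sum>v\<in>range \<sigma>. (c $ inv \<sigma> v) *\<^sub>R v) = 0"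
      using \<open>X = 0\<close> inj by (simp add: X_def sum.reindex)
    then have "\<forall>v\<in>range \<sigma>. c $ inv \<sigma> v = 0"
      using ind independent_explicit_finite_subsets[of "range \<sigma>"] by fastforce
    then show "c = 0" using inj by (simp add: vec_eq_iff)
  qed
  then show ?thesis
    using matrix_left_invertible_ker invertible_left_inverse by blast
qed

lemma outcome_matrix_born_matrix:
  assumes "reference_process H \<sigma>"
  shows "outcome_matrix H \<sigma> ** born_matrix H \<sigma> = mat 1"
    and "born_matrix H \<sigma> ** outcome_matrix H \<sigma> = mat 1"
  using someI_ex[OF invertible_outcome_matrix[OF assms, unfolded invertible_def]]
  by (auto simp: born_matrix_def matrix_inv_def)

lemma column_quasistochastic_born_matrix:
  assumes "reference_process H \<sigma>"
  shows "column_quasistochastic (born_matrix H \<sigma>)"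
proof -
  have sH: "(\<Sum>i\<in>UNIV. H i) = mat 1" and tr: "trace (\<sigma> j) = 1" for j
    using assms by (auto simp: reference_process_def MIC_def density_operator_def)
  have "(\<Sum>i\<in>UNIV. outcome_matrix H \<sigma> $ i $ j) = 1" for j
  proof -
    have "(\<Sum>i\<in>UNIV. outcome_matrix H \<sigma> $ i $ j) = Re (trace (\<sigma> j ** (\<Sum>i\<in>UNIV. H i)))"
      using trace_mult_cmul_sum[of "\<sigma> j" "\<lambda>_. 1" H]
      by (simp add: outcome_matrix_def trace_mul_sym[of "\<sigma> j"])
    then show ?thesis by (simp add: sH tr)
  qed
  then have one: "1 v* outcome_matrix H \<sigma> = 1"
    by (simp add: vec_eq_iff vector_matrix_mult_def)
  have "1 v* born_matrix H \<sigma> = (1 v* outcome_matrix H \<sigma>) v* born_matrix H \<sigma>"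
    by (simp add: one)
  also have "\<dots> = 1"
    by (simp add: vector_matrix_mul_assoc outcome_matrix_born_matrix[OF assms])
  finally show ?thesis
    by (simp add: column_quasistochastic_def vec_eq_iff vector_matrix_mult_def)
qed

lemma born_matrix_SIC:
  fixes S :: "'m::finite \<Rightarrow> complex^'d^'d"
  assumes "SIC S"
  shows "born_matrix S (\<lambda>i. real CARD('d) *\<^sub>R S i) =
    (\<chi> i j. (real CARD('d) + 1) * (if i = j then 1 else 0) - 1 / real CARD('d))"
    (is "_ = ?B")
proof -
  let ?d = "real CARD('d)"
  let ?A = "outcome_matrix S (\<lambda>i. ?d *\<^sub>R S i)"
  have m: "real CARD('m) = ?d * ?d"
    using assms by (simp add: SIC_def MIC_def power2_eq_square)
  have d: "?d > 0" by simp
  have A: "?A $ i $ j = (if i = j then 1 / (?d + 1) else 0) + 1 / (?d * (?d + 1))" for i j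
  proof -
    have "trace (S i ** (?d *\<^sub>R S j)) = of_real ?d * trace (S i ** S j)"
      by (simp add: trace_def matrix_matrix_mult_def sum_distrib_left
          scaleR_conv_of_real[where 'a = complex]
          algebra_simps)
    also have "\<dots> = of_real (?d * (1 / ?d\<^sup>2 * ((?d * (if i = j then 1 else 0) + 1) / (?d + 1))))"
      using assms by (simp add: SIC_def)
    finally have "?A $ i $ j = ?d * (1 / ?d\<^sup>2 * ((?d * (if i = j then 1 else 0) + 1) / (?d + 1)))"
      unfolding outcome_matrix_def by (simp only: vec_lambda_beta Re_complex_of_real)
    then show ?thesis using d by (simp add: divide_simps power2_eq_square)
  qed
  have "(\<Sum>k\<in>UNIV. ?A $ i $ k * ?B $ k $ j) = mat 1 $ i $ j" for i j
  proof -
    have "(\<Sum>k\<in>UNIV. ?A $ i $ k * ?B $ k $ j) =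
      (\<Sum>k\<in>UNIV. (if i = k then (if k = j then 1 else 0) - 1 / (?d * (?d + 1)) else 0) +
        (if k = j then 1 / ?d else 0) - 1 / (?d * ?d * (?d + 1)))"
      using d by (intro sum.cong refl) (auto simp: A divide_simps, simp_all add: algebra_simps)
    also have "\<dots> = (if i = j then 1 else 0) - 1 / (?d * (?d + 1)) + 1 / ?d - ?d * ?d / (?d * ?d * (?d + 1))"
      by (simp add: sum.distrib sum_subtractf m)
    also have "\<dots> = mat 1 $ i $ j"
      using d by (simp add: mat_def divide_simps)
    finally show ?thesis .
  qed
  then have AB: "?A ** ?B = mat 1"
    by (simp add: vec_eq_iff matrix_matrix_mult_def)
  then have BA: "?B ** ?A = mat 1"
    using matrix_left_right_inverse by blast
  have "invertible ?A" using AB BA unfolding invertible_def by blast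
  then have inv: "matrix_inv ?A ** ?A = mat 1"
    unfolding invertible_def matrix_inv_def by (rule someI2_ex) simp
  have "matrix_inv ?A = (matrix_inv ?A ** ?A) ** ?B"
    using AB by (simp only: matrix_mul_assoc[symmetric] matrix_mul_rid)
  then show ?thesis
    unfolding born_matrix_def by (simp only: inv matrix_mul_lid)
qed

end

theory Submission
  imports Defs
begin

text \<open>
  Write \<open>A = \<Phi>\<^sup>-\<^sup>1\<close>, \<open>h\<^sub>i = tr H\<^sub>i\<close> and \<open>N = d\<^sup>2\<close>.  Expanding the states in the basis \<open>H\<close> shows that
  \<open>(det A)\<^sup>2\<close> is the product of the Gram determinants of \<open>H\<close> and \<open>\<sigma>\<close>, i.e. of \<open>\<Prod>\<^sub>i d h\<^sub>i \<le> 1\<close> and the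
  determinants of the Gram matrices \<open>M\<close> of \<open>H\<^sub>i / \<surd>h\<^sub>i\<close> and \<open>K\<close> of \<open>\<sigma>\<^sub>i / \<surd>d\<close>.  Both Gram matrices have
  trace at most \<open>d\<close> and a Rayleigh quotient at least 1 in a known direction, \<open>(\<surd>h\<^sub>i)\<^sub>i\<close> respectively
  \<open>(1, \<dots>, 1)\<close>.  By the arithmetic-geometric mean inequality their determinants are at most
  \<open>(d + 1)\<^bsup>1 - N\<^esup>\<close>, and equality pins down all their entries.  For the log-majorization, \<open>\<Phi>\<close> has a
  singular value at most 1 because its columns sum to 1, so its other \<open>N - 1\<close> singular values have
  product at least \<open>(d + 1)\<^bsup>N - 1\<^esup>\<close>.
\<close>

section \<open>Diagonalization of symmetric matrices\<close>

text \<open>Letting \<open>t\<close> tend to 0 gives the claim. It serves first-order variation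
  arguments, at the maximum of a Rayleigh quotient and at a zero of a positive semidefinite
  form.\<close>

lemma nonpos_if_le_small_multiples:
  fixes a K :: real
  assumes "\<And>t. t > 0 \<Longrightarrow> 2 * a \<le> t * K"
  shows "a \<le> 0"
proof (rule ccontr)
  assume "\<not> a \<le> 0"
  then have a: "a > 0" by simp
  with assms[of 1] have K: "K > 0" by simp
  from assms[of "a / K"] a K show False by simp
qed

text \<open>A maximizer \<open>u\<close> of the Rayleigh quotient on the unit sphere of
  \<open>V\<close> exists by compactness. Moving \<open>u\<close> towards its residual
  \<open>f u - m *\<^sub>R u\<close>, which lies in \<open>V\<close>, would increase the quotient to
  first order unless the residual vanishes.\<close>

lemma self_adjoint_eigenvector:
  fixes f :: "'a::euclidean_space \<Rightarrow> 'a"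
  assumes lin: "linear f" and sa: "\<And>x y. f x \<bullet> y = x \<bullet> f y"
    and V: "subspace V" "f ` V \<subseteq> V" "V \<noteq> {0}"
  obtains u c where "u \<in> V" "norm u = 1" "f u = c *\<^sub>R u"
proof -
  let ?S = "sphere 0 1 \<inter> V"
  obtain x where x: "x \<in> V" "x \<noteq> 0"
    using V(1,3) subspace_0 by blast
  then have "x /\<^sub>R norm x \<in> ?S"
    using V(1) by (simp add: subspace_scale)
  moreover have "compact ?S"
    by (intro compact_Int_closed compact_sphere closed_subspace V)
  moreover have "continuous_on ?S (\<lambda>x. x \<bullet> f x)"
    using lin by (intro continuous_intros linear_continuous_on) (simp add: linear_conv_bounded_linear)
  ultimately obtain u where u: "u \<in> ?S" and max: "\<And>y. y \<in> ?S \<Longrightarrow> y \<bullet> f y \<le> u \<bullet> f u"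
    using continuous_attains_sup[of ?S "\<lambda>x. x \<bullet> f x"] by blast
  define m where "m = u \<bullet> f u"
  have uV: "u \<in> V" and nu: "norm u = 1" using u by auto
  \<comment> \<open>Homogeneity carries the maximum from the sphere to all of
    \<open>V\<close>.\<close>
  have bound: "y \<bullet> f y \<le> m * (y \<bullet> y)" if "y \<in> V" for y
  proof (cases "y = 0")
    case False
    then have "y /\<^sub>R norm y \<in> ?S"
      using that V(1) by (simp add: subspace_scale)
    then have "(y /\<^sub>R norm y) \<bullet> f (y /\<^sub>R norm y) \<le> m"
      unfolding m_def by (rule max)
    then show ?thesis
      using False by (simp add: linear_scale[OF lin] divide_simps power2_norm_eq_inner[symmetric] power2_eq_square
          split: if_splits)
  qed (simp add: linear_0[OF lin])
  define w where "w = f u - m *\<^sub>R u"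
  define K where "K = m * (w \<bullet> w) - w \<bullet> f w"
  have wV: "w \<in> V"
    unfolding w_def using V uV by (intro subspace_diff subspace_scale) auto
  \<comment> \<open>the first variation of the Rayleigh quotient at its maximum, in the direction of the residual\<close>
  have var: "2 * (w \<bullet> w) \<le> t * K" if "t > 0" for t
  proof -
    have "u + t *\<^sub>R w \<in> V"
      using V(1) uV wV by (intro subspace_add subspace_scale)
    from bound[OF this]
    have "u \<bullet> f u + t * (u \<bullet> f w + w \<bullet> f u) + t * t * (w \<bullet> f w)
        \<le> m * (u \<bullet> u) + t * (2 * m * (u \<bullet> w)) + t * t * (m * (w \<bullet> w))"
      by (simp add: linear_add[OF lin] linear_scale[OF lin] algebra_simps inner_commute)
    moreover have "u \<bullet> f w = w \<bullet> f u"
      by (metis sa inner_commute)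
    moreover have "u \<bullet> u = 1" using nu by (simp add: norm_eq_1)
    moreover have "w \<bullet> f u = w \<bullet> w + m * (u \<bullet> w)"
      unfolding w_def by (simp add: algebra_simps inner_commute)
    ultimately have "t * (2 * (w \<bullet> w)) \<le> t * (t * K)"
      by (simp add: m_def[symmetric] K_def algebra_simps)
    then show ?thesis using that by simp
  qed
  have "w \<bullet> w \<le> 0"
    using var by (rule nonpos_if_le_small_multiples)
  then have "w = 0" using inner_ge_zero[of w] inner_eq_zero_iff[of w] by linarith
  then have "f u = m *\<^sub>R u" by (simp add: w_def)
  with uV nu show thesis by (rule that)
qed

text \<open>Induction on the dimension: an eigenvector is split off, and its orthogonal complement
  in \<open>V\<close> is again invariant because \<open>f\<close> is self-adjoint.\<close>

lemma self_adjoint_eigenbasis: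
  fixes f :: "'a::euclidean_space \<Rightarrow> 'a"
  assumes lin: "linear f" and sa: "\<And>x y. f x \<bullet> y = x \<bullet> f y"
    and "subspace V" "f ` V \<subseteq> V"
  shows "\<exists>B\<subseteq>V. finite B \<and> card B = dim V \<and> pairwise orthogonal B
    \<and> (\<forall>b\<in>B. norm b = 1 \<and> (\<exists>c. f b = c *\<^sub>R b))"
  using assms(3,4)
proof (induction "dim V" arbitrary: V)
  case 0
  then show ?case by (intro exI[of _ "{}"]) auto
next
  case (Suc n)
  have "V \<noteq> {0}" using Suc.hyps(2) by auto
  then obtain u c where u: "u \<in> V" "norm u = 1" "f u = c *\<^sub>R u"
    using self_adjoint_eigenvector[OF lin sa Suc.prems] by blast
  define W where "W = {x \<in> V. orthogonal u x}"
  have W: "subspace W"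
    unfolding W_def using Suc.prems(1)
    by (auto simp: subspace_def orthogonal_def algebra_simps)
  have fW: "f ` W \<subseteq> W"
    using Suc.prems(2) u(3) by (auto simp: W_def orthogonal_def sa[symmetric])
  have "dim {y \<in> span V. \<forall>x \<in> span {u}. orthogonal x y} + dim (span {u}) = dim (span V)"
    using dim_subspace_orthogonal_to_vectors[of "span {u}" "span V"] u(1)
    by (simp add: span_mono)
  moreover have "{y \<in> span V. \<forall>x \<in> span {u}. orthogonal x y} = W"
    using Suc.prems(1) by (auto simp: W_def span_eq_iff[THEN iffD2] orthogonal_def span_singleton)
  moreover have "dim {u} = 1" using u(2) by (simp add: dim_singleton) auto
  ultimately have "n = dim W" using Suc.hyps(2) by simp
  from Suc.hyps(1)[OF this W fW] obtain B where
    B: "B \<subseteq> W" "finite B" "card B = dim W" "pairwise orthogonal B"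
      "\<forall>b\<in>B. norm b = 1 \<and> (\<exists>c. f b = c *\<^sub>R b)" by blast
  have "u \<notin> B" using B(1) u(2) by (auto simp: W_def orthogonal_def)
  show ?case
  proof (intro exI conjI)
    show "insert u B \<subseteq> V" using B(1) u(1) by (auto simp: W_def)
    show "card (insert u B) = dim V"
      using B \<open>u \<notin> B\<close> \<open>n = dim W\<close> Suc.hyps(2) by simp
    show "pairwise orthogonal (insert u B)"
      using B(1,4) by (auto simp: pairwise_insert W_def orthogonal_commute)
  qed (use B u in auto)
qed

definition diag_mat :: "('n \<Rightarrow> 'a::zero) \<Rightarrow> 'a^'n^'n" where
  "diag_mat f = (\<chi> i j. if i = j then f i else 0)"

text \<open>The rows of \<open>Q\<close> form an orthonormal eigenbasis, and \<open>e\<close> lists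
  the eigenvalues.\<close>

theorem symmetric_matrix_diagonalization:
  fixes A :: "real^'n^'n"
  assumes "transpose A = A"
  obtains Q e where "orthogonal_matrix Q" "A = transpose Q ** diag_mat e ** Q"
proof -
  have sa: "(A *v x) \<bullet> y = x \<bullet> (A *v y)" for x y
    using dot_lmul_matrix[of x A y] assms by (metis transpose_matrix_vector)
  obtain B where B: "finite B" "card B = CARD('n)" "pairwise orthogonal B"
    "\<forall>b\<in>B. norm b = 1 \<and> (\<exists>c. A *v b = c *\<^sub>R b)"
    using self_adjoint_eigenbasis[of "(*v) A" UNIV] sa by auto
  obtain b where b: "bij_betw b (UNIV :: 'n set) B"
    using B(1,2) by (metis finite_class.finite_UNIV finite_same_card_bij)
  then have bB: "b i \<in> B" for i by (auto simp: bij_betw_def)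
  have "\<forall>i. \<exists>c. A *v b i = c *\<^sub>R b i"
    using B(4) bB by blast
  then obtain e where e: "\<And>i. A *v b i = e i *\<^sub>R b i"
    by (auto dest!: choice)
  define Q :: "real^'n^'n" where "Q = (\<chi> i. b i)"
  have orth: "orthogonal (b i) (b j)" if "i \<noteq> j" for i j
    using that b bB B(3) by (metis bij_betw_imp_inj_on injD pairwiseD)
  have Q: "orthogonal_matrix Q"
    unfolding orthogonal_matrix_orthonormal_rows
    using B(4) bB orth by (auto simp: Q_def row_def)
  have "A ** transpose Q = transpose Q ** diag_mat e"
  proof -
    have "(A ** transpose Q) $ i $ j = (transpose Q ** diag_mat e) $ i $ j" for i j
    proof -
      have "(A ** transpose Q) $ i $ j = (A *v b j) $ i"
        by (simp add: matrix_matrix_mult_def matrix_vector_mult_def transpose_def Q_def)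
      also have "\<dots> = (transpose Q ** diag_mat e) $ i $ j"
        by (simp add: e matrix_matrix_mult_def transpose_def Q_def diag_mat_def if_distrib cong: if_cong)
      finally show ?thesis .
    qed
    then show ?thesis by (simp add: vec_eq_iff)
  qed
  then have "A ** (transpose Q ** Q) = transpose Q ** diag_mat e ** Q"
    by (simp add: matrix_mul_assoc)
  then have "A = transpose Q ** diag_mat e ** Q"
    using Q by (simp add: orthogonal_matrix)
  with Q show thesis by (rule that)
qed

lemma det_diag_mat: "det (diag_mat f :: 'a::comm_ring_1^'n^'n) = (\<Prod>i\<in>UNIV. f i)"
  by (subst det_diagonal) (auto simp: diag_mat_def)

lemma trace_diag_mat: "trace (diag_mat f :: 'a::comm_semiring_1^'n^'n) = (\<Sum>i\<in>UNIV. f i)"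
  by (simp add: trace_def diag_mat_def)

lemma det_conj_orthogonal:
  fixes Q A :: "real^'n^'n"
  assumes "orthogonal_matrix Q"
  shows "det (transpose Q ** A ** Q) = det A"
proof -
  have "det Q * det Q = 1"
    using det_orthogonal_matrix[OF assms] by auto
  then show ?thesis by (simp add: det_mul mult.assoc mult.left_commute[of "det Q"])
qed

lemma trace_conj_orthogonal:
  fixes Q A :: "real^'n^'n"
  assumes "orthogonal_matrix Q"
  shows "trace (transpose Q ** A ** Q) = trace A"
proof -
  have "trace (transpose Q ** A ** Q) = trace (Q ** (transpose Q ** A))"
    by (rule trace_mul_sym)
  also have "\<dots> = trace A"
    using assms by (simp add: matrix_mul_assoc orthogonal_matrix_def)
  finally show ?thesis .
qed

section \<open>Characteristic polynomial and singular values from a diagonalization\<close>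

lemma matrix_add_rdistrib: "(A + B) ** C = A ** C + B ** C"
  by (simp add: matrix_matrix_mult_def vec_eq_iff sum.distrib algebra_simps)

lemma poly_char_polynomial: "poly (char_polynomial A) x = det (mat x - A)"
  unfolding char_polynomial_def det_def
  by (simp add: poly_sum poly_prod sign_def mat_def map_matrix_def)
     (intro sum.cong refl arg_cong2[where f = "(*)"] prod.cong, auto)

text \<open>A real polynomial is determined by its values, and \<open>det (mat x - A)\<close> can be
  computed in diagonal form because conjugation by \<open>Q\<close> fixes
  \<open>mat x\<close>.\<close>

lemma char_polynomial_diagonalized:
  fixes Q :: "real^'n^'n"
  assumes Q: "orthogonal_matrix Q" and A: "A = transpose Q ** diag_mat e ** Q"
  shows "char_polynomial A = (\<Prod>i\<in>UNIV. [:- e i, 1:])"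
proof -
  have "poly (char_polynomial A) x = poly (\<Prod>i\<in>UNIV. [:- e i, 1:]) x" for x
  proof -
    have "mat x = transpose Q ** mat x ** Q"
    proof -
      have "mat x ** Q = x *\<^sub>R Q"
        by (simp add: matrix_matrix_mult_def mat_def vec_eq_iff if_distrib[of "\<lambda>y. y * _"] cong: if_cong)
      moreover have "transpose Q ** (x *\<^sub>R Q) = x *\<^sub>R (transpose Q ** Q)"
        by (simp add: matrix_matrix_mult_def vec_eq_iff sum_distrib_left algebra_simps)
      ultimately have "transpose Q ** mat x ** Q = x *\<^sub>R mat 1"
        using Q by (simp add: orthogonal_matrix matrix_mul_assoc[symmetric])
      then show ?thesis by (simp add: mat_def vec_eq_iff)
    qed
    then have "mat x - A = transpose Q ** (mat x - diag_mat e) ** Q"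
      using matrix_add_ldistrib[of "transpose Q" "mat x - diag_mat e" "diag_mat e"]
        matrix_add_rdistrib[of "transpose Q ** (mat x - diag_mat e)" "transpose Q ** diag_mat e" Q]
      by (simp add: A algebra_simps)
    then have "poly (char_polynomial A) x = det (mat x - diag_mat e)"
      by (simp add: poly_char_polynomial det_conj_orthogonal[OF Q])
    also have "mat x - diag_mat e = diag_mat (\<lambda>i. x - e i)"
      by (simp add: mat_def diag_mat_def vec_eq_iff)
    finally show ?thesis by (simp add: det_diag_mat poly_prod)
  qed
  then show ?thesis by (simp add: poly_eq_poly_eq_iff[symmetric] fun_eq_iff)
qed

text \<open>Connects the definition through polynomial roots with spectral data: the roots of the
  characteristic polynomial, with multiplicity, are the diagonal entries \<open>e i\<close>.\<close>

lemma mset_singular_values: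
  fixes Q :: "real^'n^'n"
  assumes "orthogonal_matrix Q" "transpose A ** A = transpose Q ** diag_mat e ** Q"
  shows "mset (singular_values A) = image_mset (\<lambda>i. sqrt (e i)) (mset_set UNIV)"
proof -
  have "proots (char_polynomial (transpose A ** A)) = (\<Sum>i\<in>UNIV. {#e i#})"
    by (simp add: char_polynomial_diagonalized[OF assms] proots_prod)
  also have "\<dots> = image_mset e (mset_set UNIV)"
    by (simp add: sum_unfold_sum_mset)
  finally show ?thesis
    by (simp add: singular_values_def multiset.map_comp comp_def)
qed

section \<open>Positive semidefinite real matrices and the arithmetic-geometric mean
  inequality\<close>

lemma conj_quadratic_form:
  fixes Q M :: "real^'n^'n"
  shows "x \<bullet> ((transpose Q ** M ** Q) *v x) = (Q *v x) \<bullet> (M *v (Q *v x))"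
proof -
  have "x \<bullet> ((transpose Q ** M ** Q) *v x) = x \<bullet> (transpose Q *v (M *v (Q *v x)))"
    by (simp add: matrix_vector_mul_assoc matrix_mul_assoc)
  also have "\<dots> = (Q *v x) \<bullet> (M *v (Q *v x))"
    by (metis dot_lmul_matrix transpose_matrix_vector transpose_transpose)
  finally show ?thesis .
qed

text \<open>The arithmetic-geometric mean inequality in normalized form, from
  \<open>e i \<le> exp (e i - 1)\<close>. In the equality case \<open>ln (e i) \<le> e i - 1\<close>
  is tight for every \<open>i\<close>, which happens only at 1.\<close>

lemma prod_le_1_if_sum_le_card:
  fixes e :: "'n::finite \<Rightarrow> real"
  assumes nn: "\<And>i. e i \<ge> 0" and s: "(\<Sum>i\<in>UNIV. e i) \<le> real CARD('n)"
  shows "(\<Prod>i\<in>UNIV. e i) \<le> 1" and "(\<Prod>i\<in>UNIV. e i) = 1 \<Longrightarrow> e i = 1"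
proof -
  have "(\<Prod>i\<in>UNIV. e i) \<le> (\<Prod>i\<in>UNIV. exp (e i - 1))"
    using exp_ge_add_one_self[of "e _ - 1"] by (intro prod_mono) (simp add: nn)
  also have "\<dots> = exp ((\<Sum>i\<in>UNIV. e i) - real CARD('n))"
    by (simp add: exp_sum[symmetric] sum_subtractf)
  also have "\<dots> \<le> 1" using s by simp
  finally show "(\<Prod>i\<in>UNIV. e i) \<le> 1" .
  assume p1: "(\<Prod>i\<in>UNIV. e i) = 1"
  then have nz: "e i \<noteq> 0" for i
    using prod_zero_iff[of UNIV e] by (metis UNIV_I finite zero_neq_one)
  then have pos: "e i > 0" for i using nn[of i] nz[of i] by linarith
  have "(\<Sum>i\<in>UNIV. ln (e i)) = ln (\<Prod>i\<in>UNIV. e i)"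
    by (rule ln_prod[symmetric]) (simp_all add: pos nz)
  then have "(\<Sum>i\<in>UNIV. e i - 1 - ln (e i)) \<le> 0"
    using p1 s by (simp add: sum_subtractf)
  moreover have "e i - 1 - ln (e i) \<ge> 0" for i
    using ln_le_minus_one[OF pos[of i]] by simp
  ultimately have "\<forall>i\<in>UNIV. e i - 1 - ln (e i) = 0"
    by (metis (no_types, lifting) finite order_antisym sum_nonneg sum_nonneg_eq_0_iff)
  then show "e i = 1"
    using ln_eq_minus_one[OF pos[of i]] by fastforce
qed

lemma psd_matrix_diagonalization:
  fixes P :: "real^'n^'n"
  assumes sym: "transpose P = P" and psd: "\<And>x. 0 \<le> x \<bullet> (P *v x)"
  obtains Q e where "orthogonal_matrix Q" "P = transpose Q ** diag_mat e ** Q" "\<And>i. e i \<ge> 0"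
proof -
  obtain Q e where Q: "orthogonal_matrix Q" and P: "P = transpose Q ** diag_mat e ** Q"
    using symmetric_matrix_diagonalization[OF sym] by blast
  have "e i \<ge> 0" for i
  proof -
    \<comment> \<open>This is row \<open>i\<close> of \<open>Q\<close>, so its quadratic form is the
      eigenvalue \<open>e i\<close>.\<close>
    define x where "x = transpose Q *v axis i 1"
    have Qx: "Q *v x = axis i 1"
      using Q by (simp add: x_def matrix_vector_mul_assoc orthogonal_matrix_def
          del: transpose_matrix_vector)
    have "x \<bullet> (P *v x) = (Q *v x) \<bullet> (diag_mat e *v (Q *v x))"
      unfolding P by (rule conj_quadratic_form)
    also have "\<dots> = e i"
      by (simp add: Qx inner_axis' matrix_vector_mult_basis column_def diag_mat_def)
    finally show ?thesis using psd[of x] by simp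
  qed
  with Q P show thesis by (rule that)
qed

lemma psd_matrix_det_nonneg:
  fixes P :: "real^'n^'n"
  assumes "transpose P = P" and "\<And>x. 0 \<le> x \<bullet> (P *v x)"
  shows "0 \<le> det P"
  by (rule psd_matrix_diagonalization[OF assms])
     (simp add: det_conj_orthogonal det_diag_mat prod_nonneg)

text \<open>The arithmetic-geometric mean inequality for the eigenvalues, whose sum is the trace and
  whose product is the determinant. If all of them are 1, then \<open>P\<close> is the
  identity.\<close>

lemma det_le_1_if_trace_le_card:
  fixes P :: "real^'n^'n"
  assumes sym: "transpose P = P" and psd: "\<And>x. 0 \<le> x \<bullet> (P *v x)"
    and tr: "trace P \<le> real CARD('n)"
  shows "det P \<le> 1" and "det P = 1 \<Longrightarrow> P = mat 1"
proof -
  obtain Q e where Q: "orthogonal_matrix Q" and P: "P = transpose Q ** diag_mat e ** Q"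
    and e: "\<And>i. e i \<ge> 0"
    using psd_matrix_diagonalization[OF sym psd] by blast
  have detP: "det P = (\<Prod>i\<in>UNIV. e i)"
    by (simp add: P det_conj_orthogonal[OF Q] det_diag_mat)
  have sum: "(\<Sum>i\<in>UNIV. e i) \<le> real CARD('n)"
    using tr by (simp add: P trace_conj_orthogonal[OF Q] trace_diag_mat)
  show "det P \<le> 1"
    unfolding detP by (rule prod_le_1_if_sum_le_card(1)[OF e sum])
  assume "det P = 1"
  then have "e i = 1" for i
    unfolding detP by (rule prod_le_1_if_sum_le_card(2)[OF e sum])
  then have "diag_mat e = mat 1" by (simp add: diag_mat_def mat_def vec_eq_iff)
  then show "P = mat 1" using Q by (simp add: P orthogonal_matrix)
qed

section \<open>Determinant bounds for Gram matrices\<close>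

lemma diag_mat_mult: "diag_mat f ** diag_mat g = diag_mat (\<lambda>i. f i * g i :: 'a::comm_semiring_1)"
  by (simp add: diag_mat_def matrix_matrix_mult_def vec_eq_iff if_distrib[of "\<lambda>y. y * _"] cong: if_cong)

lemma transpose_diag_mat [simp]: "transpose (diag_mat f) = diag_mat f"
  by (auto simp: diag_mat_def transpose_def vec_eq_iff)

lemma diag_conj_mult:
  fixes Q :: "real^'n^'n"
  assumes "orthogonal_matrix Q"
  shows "(transpose Q ** diag_mat f ** Q) ** (transpose Q ** diag_mat g ** Q)
    = transpose Q ** diag_mat (\<lambda>i. f i * g i) ** Q"
proof -
  have "(transpose Q ** diag_mat f ** Q) ** (transpose Q ** diag_mat g ** Q)
    = transpose Q ** (diag_mat f ** ((Q ** transpose Q) ** (diag_mat g ** Q)))"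
    by (simp only: matrix_mul_assoc)
  also have "\<dots> = transpose Q ** (diag_mat f ** diag_mat g) ** Q"
    using assms by (simp add: orthogonal_matrix_def matrix_mul_assoc)
  finally show ?thesis by (simp only: diag_mat_mult)
qed

text \<open>This is \<open>a I + b v v^T\<close>. For a unit vector \<open>v\<close> it has
  eigenvalue \<open>a + b\<close> along \<open>v\<close> and \<open>a\<close> on the orthogonal
  complement. \<open>\<Phi>_SIC\<close> and, up to a scalar factor, the Gram matrices of SICs have
  this form.\<close>

definition scalar_plus_rank_one :: "real \<Rightarrow> real \<Rightarrow> real^'n \<Rightarrow> real^'n^'n" where
  "scalar_plus_rank_one a b v = (\<chi> i j. (if i = j then a else 0) + b * (v $ i * v $ j))"

lemma transpose_scalar_plus_rank_one [simp]:
  "transpose (scalar_plus_rank_one a b v) = scalar_plus_rank_one a b v"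
  by (auto simp: scalar_plus_rank_one_def transpose_def vec_eq_iff)

text \<open>\<open>Q\<close> has \<open>v\<close> as its row \<open>k\<close> and does not depend on
  \<open>a\<close> and \<open>b\<close>: all these matrices are diagonalized simultaneously, so
  determinants and products reduce to eigenvalues.\<close>

lemma scalar_plus_rank_one_diagonalization:
  fixes v :: "real^'n"
  assumes "norm v = 1"
  obtains Q where "orthogonal_matrix Q"
    "\<And>a b. scalar_plus_rank_one a b v =
      transpose Q ** diag_mat (\<lambda>i. if i = k then a + b else a) ** Q"
proof -
  obtain B where B: "orthogonal_matrix B" "B *v axis k 1 = v"
    using orthogonal_matrix_exists_basis[OF assms] by metis
  define Q where "Q = transpose B"
  have Q: "orthogonal_matrix Q" using B(1) by (simp add: Q_def)
  have Qv: "Q $ k $ i = v $ i" for i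
    using B(2) by (auto simp: Q_def transpose_def matrix_vector_mult_basis column_def)
  have QQ: "(\<Sum>l\<in>UNIV. Q $ l $ i * Q $ l $ j) = (if i = j then 1 else 0)" for i j
    using Q by (auto simp: orthogonal_matrix vec_eq_iff matrix_matrix_mult_def transpose_def mat_def)
  have "scalar_plus_rank_one a b v =
      transpose Q ** diag_mat (\<lambda>i. if i = k then a + b else a) ** Q" for a b
  proof -
    have "(transpose Q ** diag_mat (\<lambda>i. if i = k then a + b else a) ** Q) $ i $ j
      = (if i = j then a else 0) + b * (v $ i * v $ j)" for i j
    proof -
      have "(transpose Q ** diag_mat (\<lambda>i. if i = k then a + b else a) ** Q) $ i $ j
        = (\<Sum>l\<in>UNIV. Q $ l $ i * (if l = k then a + b else a) * Q $ l $ j)"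
        by (simp add: matrix_matrix_mult_def transpose_def diag_mat_def
            if_distrib[of "\<lambda>y. _ * y"] cong: if_cong)
      also have "\<dots> = (\<Sum>l\<in>UNIV. a * (Q $ l $ i * Q $ l $ j) + (if l = k then b * (Q $ k $ i * Q $ k $ j) else 0))"
        by (intro sum.cong) (auto simp: algebra_simps)
      also have "\<dots> = a * (\<Sum>l\<in>UNIV. Q $ l $ i * Q $ l $ j) + b * (v $ i * v $ j)"
        by (simp add: sum.distrib sum_distrib_left Qv)
      finally show ?thesis by (simp add: QQ)
    qed
    then show ?thesis by (simp add: scalar_plus_rank_one_def vec_eq_iff)
  qed
  with Q show thesis by (rule that)
qed

lemma prod_if_eq_else: "(\<Prod>i\<in>UNIV. if i = k then a else b) = (a::'a::comm_monoid_mult) * b ^ (CARD('n) - 1)"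
  for k :: "'n::finite"
proof -
  have "(\<Prod>i\<in>UNIV. if i = k then a else b) = a * (\<Prod>i\<in>UNIV - {k}. if i = k then a else b)"
    by (simp add: prod.remove[of UNIV k])
  also have "(\<Prod>i\<in>UNIV - {k}. if i = k then a else b) = (\<Prod>i\<in>UNIV - {k}. b)"
    by (intro prod.cong) auto
  finally show ?thesis by (simp add: card_Diff_singleton)
qed

lemma det_scalar_plus_rank_one:
  fixes v :: "real^'n"
  assumes "norm v = 1"
  shows "det (scalar_plus_rank_one a b v) = (a + b) * a ^ (CARD('n) - 1)"
proof -
  fix k :: 'n
  obtain Q where Q: "orthogonal_matrix Q"
    "\<And>a b. scalar_plus_rank_one a b v = transpose Q ** diag_mat (\<lambda>i. if i = k then a + b else a) ** Q"
    using scalar_plus_rank_one_diagonalization[OF assms, where k = k] by blast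
  then show ?thesis by (simp add: det_conj_orthogonal det_diag_mat prod_if_eq_else)
qed

text \<open>Eigenvalues multiply: \<open>(a + b) * (c + e)\<close> along \<open>v\<close> and
  \<open>a * c\<close> on its complement. The rank-one coefficient is their difference.\<close>

lemma scalar_plus_rank_one_mult:
  fixes v :: "real^'n"
  assumes "norm v = 1"
  shows "scalar_plus_rank_one a b v ** scalar_plus_rank_one c e v
    = scalar_plus_rank_one (a * c) ((a + b) * (c + e) - a * c) v"
proof -
  fix k :: 'n
  obtain Q where Q: "orthogonal_matrix Q"
    "\<And>a b. scalar_plus_rank_one a b v = transpose Q ** diag_mat (\<lambda>i. if i = k then a + b else a) ** Q"
    using scalar_plus_rank_one_diagonalization[OF assms, where k = k] by blast
  have "(\<lambda>i. (if i = k then a + b else a) * (if i = k then c + e else c))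
    = (\<lambda>i. if i = k then a * c + ((a + b) * (c + e) - a * c) else a * c)" by auto
  then show ?thesis by (simp add: Q(2) diag_conj_mult[OF Q(1)])
qed

lemma scalar_plus_rank_one_1_0: "scalar_plus_rank_one 1 0 v = mat 1"
  by (simp add: scalar_plus_rank_one_def mat_def vec_eq_iff)

lemma trace_mult_scalar_plus_rank_one:
  "trace (M ** scalar_plus_rank_one a b v) = a * trace M + b * (v \<bullet> (M *v v))"
proof -
  have "trace (M ** scalar_plus_rank_one a b v)
    = (\<Sum>i\<in>UNIV. a * M $ i $ i + b * (v $ i * (\<Sum>j\<in>UNIV. M $ i $ j * v $ j)))"
    unfolding trace_def matrix_matrix_mult_def scalar_plus_rank_one_def
    by (intro sum.cong)
       (simp_all add: distrib_left sum.distrib if_distrib[of "\<lambda>y. _ * y"] sum_distrib_left algebra_simps cong: if_cong)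
  then show ?thesis
    by (simp add: sum.distrib sum_distrib_left trace_def inner_vec_def matrix_vector_mult_def)
qed

text \<open>Rescaling by the square root of \<open>(d + 1) I - d v v\<^sup>T\<close> reduces the bound to the inequality
  between the determinant and the trace.\<close>

lemma det_bound_trace_direction:
  fixes M :: "real^'n^'n" and d :: real
  assumes sym: "transpose M = M" and psd: "\<And>x. 0 \<le> x \<bullet> (M *v x)"
    and v: "norm v = 1" and d: "d > 0" "d\<^sup>2 = real CARD('n)"
    and tr: "trace M \<le> d" and dir: "v \<bullet> (M *v v) \<ge> 1"
  shows "det M * (d + 1) ^ (CARD('n) - 1) \<le> 1"
    and "det M * (d + 1) ^ (CARD('n) - 1) = 1 \<Longrightarrow>
      trace M = d \<and> v \<bullet> (M *v v) = 1 \<and> M = scalar_plus_rank_one (1 / (d + 1)) (d / (d + 1)) v"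
proof -
  define r where "r = sqrt (d + 1)"
  have r: "r > 0" "r * r = d + 1" using d by (simp_all add: r_def)
  \<comment> \<open>\<open>S\<close> has eigenvalue 1 along \<open>v\<close> and \<open>r\<close> on
    the complement, so its square is \<open>(d + 1) I - d v v^T\<close>. The matrix
    \<open>R\<close>, defined next, is the inverse of \<open>S\<close>.\<close>
  define S where "S = scalar_plus_rank_one r (1 - r) v"
  define R where "R = scalar_plus_rank_one (1 / r) (1 - 1 / r) v"
  have symS: "transpose S = S" by (simp add: S_def)
  have SS: "S ** S = scalar_plus_rank_one (d + 1) (- d) v"
    by (simp add: S_def scalar_plus_rank_one_mult[OF v] r)
  have RS: "R ** S = mat 1" "S ** R = mat 1"
    using r by (simp_all add: R_def S_def scalar_plus_rank_one_mult[OF v] scalar_plus_rank_one_1_0)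
  have RR: "R ** R = scalar_plus_rank_one (1 / (d + 1)) (d / (d + 1)) v"
    using d by (simp add: R_def scalar_plus_rank_one_mult[OF v] r divide_simps)
  have detS: "det S * det S = (d + 1) ^ (CARD('n) - 1)"
    by (simp add: S_def det_scalar_plus_rank_one[OF v] power_mult_distrib[symmetric] r)
  define P where "P = S ** M ** S"
  have symP: "transpose P = P"
    by (simp add: P_def matrix_transpose_mul sym symS matrix_mul_assoc)
  have psdP: "0 \<le> x \<bullet> (P *v x)" for x
  proof -
    have "x \<bullet> (P *v x) = (S *v x) \<bullet> (M *v (S *v x))"
      using conj_quadratic_form[of x S M] by (simp only: P_def symS)
    then show ?thesis using psd[of "S *v x"] by simp
  qed
  have "trace P = trace (M ** (S ** S))"
    using trace_mul_sym[of S "M ** S"] by (simp add: P_def matrix_mul_assoc)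
  then have trP: "trace P = (d + 1) * trace M - d * (v \<bullet> (M *v v))"
    by (simp add: SS trace_mult_scalar_plus_rank_one)
  \<comment> \<open>A larger trace of \<open>M\<close> and a smaller Rayleigh quotient both increase
    \<open>trace P\<close>, so the two hypotheses bound it by
    \<open>(d + 1) * d - d = d^2\<close>.\<close>
  have le: "(d + 1) * trace M \<le> (d + 1) * d" "d * 1 \<le> d * (v \<bullet> (M *v v))"
    using d tr dir by (intro mult_left_mono; simp)+
  then have trP_le: "trace P \<le> real CARD('n)"
    unfolding trP d(2)[symmetric] by (simp add: algebra_simps power2_eq_square)
  have detP: "det P = det M * (d + 1) ^ (CARD('n) - 1)"
    unfolding detS[symmetric] by (simp add: P_def det_mul)
  show "det M * (d + 1) ^ (CARD('n) - 1) \<le> 1"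
    using det_le_1_if_trace_le_card(1)[OF symP psdP trP_le] by (simp add: detP)
  assume "det M * (d + 1) ^ (CARD('n) - 1) = 1"
  then have P: "P = mat 1"
    using det_le_1_if_trace_le_card(2)[OF symP psdP trP_le] by (simp add: detP)
  \<comment> \<open>As the identity, \<open>P\<close> attains the trace bound, so both inequalities
    in \<open>le\<close> are tight.\<close>
  then have "trace P = (d + 1) * d - d * 1"
    using d(2) by (simp add: trace_def mat_def algebra_simps power2_eq_square)
  then have "(d + 1) * trace M = (d + 1) * d" "d * (v \<bullet> (M *v v)) = d * 1"
    using le unfolding trP by linarith+
  \<comment> \<open>Undoing the rescaling turns \<open>P = mat 1\<close> into
    \<open>M = R ** R\<close>.\<close>
  moreover have "M = R ** (S ** M ** S) ** R"
  proof -
    have "R ** (S ** M ** S) ** R = (R ** S) ** M ** (S ** R)"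
      by (simp only: matrix_mul_assoc)
    then show ?thesis by (simp add: RS)
  qed
  ultimately show "trace M = d \<and> v \<bullet> (M *v v) = 1 \<and> M = scalar_plus_rank_one (1 / (d + 1)) (d / (d + 1)) v"
    using d(1) P RR by (simp add: P_def[symmetric])
qed

section \<open>Gram matrices and change of basis\<close>

definition gram :: "('n::finite \<Rightarrow> 'a::real_inner) \<Rightarrow> real^'n^'n" where
  "gram B = (\<chi> i j. B i \<bullet> B j)"

lemma transpose_gram [simp]: "transpose (gram B) = gram B"
  by (simp add: gram_def transpose_def vec_eq_iff inner_commute)

lemma gram_quadratic_form: "x \<bullet> (gram B *v x) = (norm (\<Sum>i\<in>UNIV. x $ i *\<^sub>R B i))\<^sup>2"
  by (simp add: power2_norm_eq_inner inner_sum_left inner_sum_right gram_def inner_vec_def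
      matrix_vector_mult_def sum_distrib_left inner_commute[of "B _" "B _"] mult_ac)

lemma trace_gram: "trace (gram B) = (\<Sum>i\<in>UNIV. (norm (B i))\<^sup>2)"
  by (simp add: trace_def gram_def power2_norm_eq_inner)


lemma det_gram_nonneg: "0 \<le> det (gram B)"
  by (rule psd_matrix_det_nonneg) (simp_all add: gram_quadratic_form)

lemma det_gram_scaleR: "det (gram (\<lambda>i. s i *\<^sub>R B i)) = (\<Prod>i\<in>UNIV. s i)\<^sup>2 * det (gram B)"
proof -
  have "gram (\<lambda>i. s i *\<^sub>R B i) = diag_mat s ** gram B ** diag_mat s"
    by (simp add: gram_def diag_mat_def matrix_matrix_mult_def vec_eq_iff mult_ac
        if_distrib[of "\<lambda>y. y * _"] if_distrib[of "\<lambda>y. _ * y"] cong: if_cong)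
  then show ?thesis by (simp add: det_mul det_diag_mat power2_eq_square)
qed

lemma span_range_expansion:
  fixes B :: "'n::finite \<Rightarrow> 'a::real_vector"
  assumes "inj B" "x \<in> span (range B)"
  obtains c where "x = (\<Sum>i\<in>UNIV. c i *\<^sub>R B i)"
proof -
  obtain u where "x = (\<Sum>v\<in>range B. u v *\<^sub>R v)"
    using assms(2) by (auto simp: span_finite)
  then have "x = (\<Sum>i\<in>UNIV. u (B i) *\<^sub>R B i)"
    using assms(1) by (simp add: sum.reindex)
  then show thesis by (rule that)
qed

text \<open>Independence of the set \<open>range B\<close> becomes a statement about indexed
  coefficients by transporting them along \<open>inv B\<close>.\<close>

lemma independent_range_coeff_0:
  fixes B :: "'n::finite \<Rightarrow> 'a::real_vector"
  assumes "inj B" "independent (range B)" "(\<Sum>i\<in>UNIV. c i *\<^sub>R B i) = 0"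
  shows "c i = 0"
proof -
  have "(\<Sum>v\<in>range B. (c (inv B v)) *\<^sub>R v) = 0"
    using assms(1,3) by (simp add: sum.reindex)
  then have "\<forall>v\<in>range B. c (inv B v) = 0"
    using assms(2) independent_explicit_finite_subsets[of "range B"] by fastforce
  then show ?thesis using assms(1) by simp
qed

text \<open>Column \<open>j\<close> of \<open>C\<close> holds coordinates of \<open>T j\<close> in
  the family \<open>B\<close>; bilinearity then factors both matrices of inner products through
  \<open>gram B\<close>.\<close>

lemma change_of_basis_matrix:
  fixes B T :: "'n::finite \<Rightarrow> 'a::real_inner"
  assumes "inj B" "range T \<subseteq> span (range B)"
  obtains C where "\<And>j. T j = (\<Sum>k\<in>UNIV. C $ k $ j *\<^sub>R B k)"
    "(\<chi> i j. B i \<bullet> T j) = gram B ** C" "gram T = transpose C ** gram B ** C"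
proof -
  have "\<forall>j. \<exists>c. T j = (\<Sum>k\<in>UNIV. c k *\<^sub>R B k)"
    using span_range_expansion[OF assms(1)] assms(2) by (metis range_subsetD)
  then obtain c where c: "\<And>j. T j = (\<Sum>k\<in>UNIV. c j k *\<^sub>R B k)"
    by (auto dest!: choice)
  define C :: "real^'n^'n" where "C = (\<chi> k j. c j k)"
  have T: "T j = (\<Sum>k\<in>UNIV. C $ k $ j *\<^sub>R B k)" for j
    using c by (simp add: C_def)
  have "(\<chi> i j. B i \<bullet> T j) = gram B ** C"
    by (simp add: T gram_def matrix_matrix_mult_def vec_eq_iff inner_sum_right mult.commute)
  moreover have "gram T = transpose C ** (\<chi> i j. B i \<bullet> T j)"
    by (subst (1) gram_def, subst (1) T)
       (simp add: matrix_matrix_mult_def vec_eq_iff inner_sum_left transpose_def)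
  ultimately show thesis using that[OF T] by (simp add: matrix_mul_assoc)
qed

text \<open>With \<open>C\<close> the change of basis matrix, both sides equal
  \<open>(det (gram B) * det C)^2\<close>.\<close>

lemma det_cross_gram_square:
  fixes B T :: "'n::finite \<Rightarrow> 'a::real_inner"
  assumes "inj B" "range T \<subseteq> span (range B)"
  shows "(det (\<chi> i j. B i \<bullet> T j))\<^sup>2 = det (gram B) * det (gram T)"
  by (rule change_of_basis_matrix[OF assms]) (simp add: det_mul power2_eq_square)

section \<open>Hermitian and positive semidefinite matrices\<close>

lemma inner_complex_vec: "v \<bullet> w = Re (\<Sum>i\<in>UNIV. cnj (v $ i) * w $ i)" for v w :: "complex^'n"
  by (simp add: inner_vec_def inner_complex_def)

lemma hermitian_entry: "hermitian A \<longleftrightarrow> (\<forall>i j. cnj (A $ i $ j) = A $ j $ i)"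
  unfolding hermitian_def conj_transpose_def vec_eq_iff vec_lambda_beta by blast

text \<open>On Hermitian matrices the trace form is the entrywise real inner product of
  \<open>complex^'d^'d\<close>, so effects and states are families in a real inner product space and
  have real Gram matrices. The imaginary part vanishes because conjugation merely swaps the two
  summation indices.\<close>

lemma trace_mult_hermitian:
  assumes "hermitian A" "hermitian B"
  shows "trace (A ** B) = complex_of_real (A \<bullet> B)"
proof (rule complex_eqI)
  have "A $ i $ j \<bullet> B $ i $ j = Re (A $ i $ j * B $ j $ i)" for i j
  proof -
    have "B $ j $ i = cnj (B $ i $ j)" using assms(2) by (simp add: hermitian_entry)
    then show ?thesis by (simp add: inner_complex_def)
  qed
  then show "Re (trace (A ** B)) = Re (complex_of_real (A \<bullet> B))"
    by (simp add: trace_def matrix_matrix_mult_def inner_vec_def)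
  have "cnj (trace (A ** B)) = (\<Sum>i\<in>UNIV. \<Sum>j\<in>UNIV. A $ j $ i * B $ i $ j)"
    using assms by (simp add: trace_def matrix_matrix_mult_def hermitian_entry)
  also have "\<dots> = trace (A ** B)"
    unfolding trace_def matrix_matrix_mult_def by (subst sum.swap) simp
  finally show "Im (trace (A ** B)) = Im (complex_of_real (A \<bullet> B))"
    by (simp add: complex_eq_iff)
qed

lemma hermitian_mat_1 [simp]: "hermitian (mat 1)"
  by (simp add: hermitian_entry mat_def)

text \<open>The trace is the inner product with the identity; it is written
  \<open>A \<bullet> mat 1\<close> in what follows.\<close>

lemma trace_hermitian: "hermitian A \<Longrightarrow> trace A = complex_of_real (A \<bullet> mat 1)"
  using trace_mult_hermitian[of A "mat 1"] by simp

lemma norm_mat_1_complex: "(norm (mat 1 :: complex^'d^'d))\<^sup>2 = real CARD('d)"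
  by (simp add: power2_norm_eq_inner inner_vec_def mat_def inner_complex_def
      if_distrib[of "\<lambda>y. _ * y"] if_distrib[of Re] if_distrib[of Im] cong: if_cong)

lemma norm_complex_matrix: "(norm A)\<^sup>2 = (\<Sum>i\<in>UNIV. \<Sum>j\<in>UNIV. (cmod (A $ i $ j))\<^sup>2)"
  for A :: "complex^'n^'m"
  by (simp add: power2_norm_eq_inner inner_vec_def)

lemma hermitian_self_adjoint:
  assumes "hermitian A"
  shows "(A *v v) \<bullet> w = v \<bullet> (A *v w)"
proof -
  have A: "cnj (A $ i $ j) = A $ j $ i" for i j
    using assms by (simp add: hermitian_entry)
  have "(A *v v) \<bullet> w = Re (\<Sum>i\<in>UNIV. \<Sum>j\<in>UNIV. A $ j $ i * cnj (v $ j) * w $ i)"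
    by (simp add: inner_complex_vec matrix_vector_mult_def sum_distrib_right A)
  also have "\<dots> = Re (\<Sum>j\<in>UNIV. \<Sum>i\<in>UNIV. A $ j $ i * cnj (v $ j) * w $ i)"
    by (subst sum.swap) simp
  finally show ?thesis
    by (simp add: inner_complex_vec matrix_vector_mult_def sum_distrib_left mult_ac)
qed

lemma matrix_vector_mult_real_scaleR: "A *v (t *\<^sub>R v) = t *\<^sub>R (A *v v)"
  for A :: "complex^'n^'m"
  by (simp add: matrix_vector_mult_def vec_eq_iff scaleR_sum_right)

lemma matrix_vector_mult_axis: "(A *v axis j 1) $ i = A $ i $ j"
  for A :: "'a::semiring_1^'n^'m"
  by (simp add: matrix_vector_mult_def axis_def if_distrib[of "\<lambda>y. _ * y"] cong: if_cong)

section \<open>Kernel, principal minors and rank of positive semidefinite matrices\<close>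

lemma pos_semidef_inner: "pos_semidef A \<longleftrightarrow> hermitian A \<and> (\<forall>v. 0 \<le> v \<bullet> (A *v v))"
  by (simp add: pos_semidef_def inner_complex_vec)

text \<open>With \<open>w = A *v v\<close>, the form at \<open>v - t *\<^sub>R w\<close> equals
  \<open>- 2 * t * (w \<bullet> w)\<close> up to second order in \<open>t\<close>, so nonnegativity
  for small positive \<open>t\<close> forces \<open>w = 0\<close>.\<close>

lemma pos_semidef_kernel:
  assumes A: "pos_semidef A" and v: "v \<bullet> (A *v v) = 0"
  shows "A *v v = 0"
proof -
  define w where "w = A *v v"
  have herm: "hermitian A" and psd: "0 \<le> x \<bullet> (A *v x)" for x
    using A by (auto simp: pos_semidef_inner)
  have "2 * (w \<bullet> w) \<le> t * (w \<bullet> (A *v w))" if "t > 0" for t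
  proof -
    have "0 \<le> (v - t *\<^sub>R w) \<bullet> (A *v (v - t *\<^sub>R w))" by (rule psd)
    also have "A *v (v - t *\<^sub>R w) = w - t *\<^sub>R (A *v w)"
      by (simp add: w_def matrix_vector_mult_diff_distrib matrix_vector_mult_real_scaleR)
    also have "(v - t *\<^sub>R w) \<bullet> (w - t *\<^sub>R (A *v w))
      = v \<bullet> w - t * (v \<bullet> (A *v w)) - t * (w \<bullet> w) + t * (t * (w \<bullet> (A *v w)))"
      by (simp add: algebra_simps)
    also have "v \<bullet> (A *v w) = w \<bullet> w"
      using hermitian_self_adjoint[OF herm, of v w] by (simp add: w_def)
    finally have "t * (2 * (w \<bullet> w)) \<le> t * (t * (w \<bullet> (A *v w)))"
      using v by (simp add: w_def)
    then show ?thesis using that by simp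
  qed
  then have "w \<bullet> w \<le> 0"
    by (rule nonpos_if_le_small_multiples)
  then show ?thesis
    using inner_ge_zero[of w] inner_eq_zero_iff[of w] unfolding w_def by linarith
qed

lemma pos_semidef_diag_nonneg:
  assumes "pos_semidef A"
  shows "0 \<le> Re (A $ i $ i)"
proof -
  have "0 \<le> axis i 1 \<bullet> (A *v axis i 1)"
    using assms by (simp add: pos_semidef_inner)
  then show ?thesis
    by (simp add: inner_axis' matrix_vector_mult_axis inner_complex_def)
qed

lemma pos_semidef_diag_real:
  assumes "pos_semidef A"
  shows "A $ i $ i = complex_of_real (Re (A $ i $ i))"
proof -
  have "cnj (A $ i $ i) = A $ i $ i"
    using assms by (simp add: pos_semidef_def hermitian_entry)
  then show ?thesis by (simp add: complex_eq_iff)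
qed

text \<open>The 2-by-2 principal minors are nonnegative: for distinct indices and
  \<open>A_ii > 0\<close>, the form at the vector \<open>v\<close> below is the Schur complement
  \<open>A_jj - |A_ij|^2 / A_ii\<close>. If it vanishes, \<open>v\<close> lies in the kernel, which
  makes column \<open>j\<close> a multiple of column \<open>i\<close>.\<close>

lemma pos_semidef_minor:
  assumes A: "pos_semidef A"
  shows "(cmod (A $ i $ j))\<^sup>2 \<le> Re (A $ i $ i) * Re (A $ j $ j)"
    and "0 < Re (A $ i $ i) \<Longrightarrow> (cmod (A $ i $ j))\<^sup>2 = Re (A $ i $ i) * Re (A $ j $ j)
      \<Longrightarrow> A $ k $ j = A $ i $ j / A $ i $ i * A $ k $ i"
proof -
  define a where "a = Re (A $ i $ i)"
  have ai: "A $ i $ i = complex_of_real a"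
    unfolding a_def by (rule pos_semidef_diag_real[OF A])
  have Aji: "A $ j $ i = cnj (A $ i $ j)"
    using A by (simp add: pos_semidef_def hermitian_entry)
  have "(cmod (A $ i $ j))\<^sup>2 \<le> a * Re (A $ j $ j)
    \<and> ((cmod (A $ i $ j))\<^sup>2 = a * Re (A $ j $ j) \<longrightarrow> A $ k $ j = A $ i $ j / A $ i $ i * A $ k $ i)"
    if a: "a > 0"
  proof (cases "i = j")
    case True
    then show ?thesis using ai a by (simp add: power2_eq_square)
  next
    case False
    \<comment> \<open>This coefficient makes entry \<open>i\<close> of \<open>A *v v\<close> vanish,
      so that only entry \<open>j\<close> contributes to the form.\<close>
    define c where "c = A $ i $ j / A $ i $ i"
    define v :: "complex^'a" where "v = axis j 1 - axis i c"
    have Av: "(A *v v) $ l = A $ l $ j - c * A $ l $ i" for l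
    proof -
      have "(A *v v) $ l = (\<Sum>m\<in>UNIV. (if m = j then A $ l $ m else 0) - (if m = i then c * A $ l $ m else 0))"
        unfolding matrix_vector_mult_def v_def axis_def
        by (auto intro!: sum.cong simp: algebra_simps)
      then show ?thesis by (simp add: sum_subtractf)
    qed
    have "(A *v v) $ i = 0" using a by (simp add: Av c_def ai)
    then have "v \<bullet> (A *v v) = Re ((A *v v) $ j)"
      by (simp add: v_def inner_diff_left inner_axis' inner_complex_def)
    also have "\<dots> = Re (A $ j $ j) - (cmod (A $ i $ j))\<^sup>2 / a"
    proof -
      have "A $ j $ j - c * A $ j $ i = A $ j $ j - complex_of_real ((cmod (A $ i $ j))\<^sup>2 / a)"
        using complex_norm_square[of "A $ i $ j"] by (simp add: c_def ai Aji)
      then show ?thesis unfolding Av by (simp only: minus_complex.sel Re_complex_of_real)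
    qed
    finally have q: "v \<bullet> (A *v v) = Re (A $ j $ j) - (cmod (A $ i $ j))\<^sup>2 / a" .
    moreover have "v \<bullet> (A *v v) \<ge> 0" using A by (simp add: pos_semidef_inner)
    ultimately have "(cmod (A $ i $ j))\<^sup>2 \<le> a * Re (A $ j $ j)"
      using a unfolding q by (simp add: pos_divide_le_eq mult.commute)
    moreover have "A $ k $ j = A $ i $ j / A $ i $ i * A $ k $ i"
      if "(cmod (A $ i $ j))\<^sup>2 = a * Re (A $ j $ j)"
    proof -
      have "v \<bullet> (A *v v) = 0" using a by (simp add: q that)
      then have "A *v v = 0" by (rule pos_semidef_kernel[OF A])
      then show ?thesis using Av[of k] by (simp add: c_def)
    qed
    ultimately show ?thesis by blast
  qed
  \<comment> \<open>If the diagonal entry is zero, the basis vector of index \<open>i\<close> lies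
    in the kernel, so column \<open>i\<close> is zero, and by hermiticity row \<open>i\<close> as
    well.\<close>
  moreover have "A $ i $ j = 0" if "\<not> a > 0"
  proof -
    have "a = 0" using that pos_semidef_diag_nonneg[OF A, of i] by (simp add: a_def)
    then have "axis i 1 \<bullet> (A *v axis i 1) = 0"
      by (simp add: inner_axis' matrix_vector_mult_axis inner_complex_def a_def)
    then have "A *v axis i 1 = 0" by (rule pos_semidef_kernel[OF A])
    then have "A $ j $ i = 0" by (metis matrix_vector_mult_axis zero_index)
    then show ?thesis using Aji by simp
  qed
  moreover have "a \<ge> 0" "Re (A $ j $ j) \<ge> 0"
    using pos_semidef_diag_nonneg[OF A] by (simp_all add: a_def)
  ultimately show "(cmod (A $ i $ j))\<^sup>2 \<le> Re (A $ i $ i) * Re (A $ j $ j)"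
    "0 < Re (A $ i $ i) \<Longrightarrow> (cmod (A $ i $ j))\<^sup>2 = Re (A $ i $ i) * Re (A $ j $ j)
      \<Longrightarrow> A $ k $ j = A $ i $ j / A $ i $ i * A $ k $ i"
    unfolding a_def[symmetric] by (cases "a > 0"; simp)+
qed

text \<open>Row \<open>i\<close> is nonzero, since otherwise all rows would vanish, and so spans the
  row space by itself.\<close>

lemma rank_eq_1_if_rows_multiples:
  fixes A :: "'a::field^'n^'m"
  assumes "A \<noteq> 0" and "\<And>j. A $ j = c j *s A $ i"
  shows "rank A = 1"
proof -
  have "A $ i \<noteq> 0"
    using assms by (metis vec_eq_iff vector_smult_rzero zero_index)
  have rows: "rows A = range (($) A)"
    by (auto simp: rows_def row_def vec_lambda_eta)
  have "vec.dim (rows A) = 1"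
  proof (rule vec.dim_unique)
    show "{A $ i} \<subseteq> rows A" by (auto simp: rows)
    show "rows A \<subseteq> vec.span {A $ i}"
      unfolding rows
    proof clarify
      fix j
      have "c j *s A $ i \<in> vec.span {A $ i}"
        by (intro vec.span_scale vec.span_base) simp
      then show "A $ j \<in> vec.span {A $ i}" by (simp only: assms(2)[of j, symmetric])
    qed
    show "vec.independent {A $ i}" using \<open>A $ i \<noteq> 0\<close> by simp
  qed simp
  then show ?thesis by (simp add: row_rank_def_gen)
qed

text \<open>Summing the minor inequalities over all index pairs bounds the squared Frobenius norm by
  the squared trace. Equality makes every minor vanish, so all columns are multiples of a single one
  and the rank is 1.\<close>

lemma pos_semidef_norm_le_trace:
  fixes A :: "complex^'d^'d"
  assumes A: "pos_semidef A"
  shows "0 \<le> A \<bullet> mat 1" and "(norm A)\<^sup>2 \<le> (A \<bullet> mat 1)\<^sup>2"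
    and "A \<noteq> 0 \<Longrightarrow> 0 < A \<bullet> mat 1"
    and "A \<noteq> 0 \<Longrightarrow> (norm A)\<^sup>2 = (A \<bullet> mat 1)\<^sup>2 \<Longrightarrow> rank A = 1"
proof -
  have herm: "hermitian A" using A by (simp add: pos_semidef_def)
  have tr: "A \<bullet> mat 1 = (\<Sum>i\<in>UNIV. Re (A $ i $ i))"
    using arg_cong[OF trace_hermitian[OF herm], of Re] by (simp add: trace_def)
  show nn: "0 \<le> A \<bullet> mat 1"
    unfolding tr by (intro sum_nonneg pos_semidef_diag_nonneg[OF A])
  have tr2: "(A \<bullet> mat 1)\<^sup>2 = (\<Sum>i\<in>UNIV. \<Sum>j\<in>UNIV. Re (A $ i $ i) * Re (A $ j $ j))"
    by (simp add: tr power2_eq_square sum_product)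
  show le: "(norm A)\<^sup>2 \<le> (A \<bullet> mat 1)\<^sup>2"
    unfolding tr2 norm_complex_matrix by (intro sum_mono pos_semidef_minor(1)[OF A])
  assume nz: "A \<noteq> 0"
  show pos: "0 < A \<bullet> mat 1"
  proof (rule ccontr)
    assume "\<not> 0 < A \<bullet> mat 1"
    then have "A \<bullet> mat 1 = 0" using nn by simp
    then show False using le nz by simp
  qed
  assume eq: "(norm A)\<^sup>2 = (A \<bullet> mat 1)\<^sup>2"
  define D where "D i j = Re (A $ i $ i) * Re (A $ j $ j) - (cmod (A $ i $ j))\<^sup>2" for i j
  have "(\<Sum>i\<in>UNIV. \<Sum>j\<in>UNIV. D i j) = 0"
    using eq by (simp add: D_def tr2 norm_complex_matrix sum_subtractf)
  moreover have D0: "0 \<le> D i j" for i j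
    using pos_semidef_minor(1)[OF A] by (simp add: D_def)
  ultimately have "D i j = 0" for i j
    by (simp add: sum_nonneg_eq_0_iff sum_nonneg)
  then have minor: "(cmod (A $ i $ j))\<^sup>2 = Re (A $ i $ i) * Re (A $ j $ j)" for i j
    unfolding D_def by (metis eq_iff_diff_eq_0)
  obtain i where i: "0 < Re (A $ i $ i)"
  proof (rule ccontr)
    assume "\<not> thesis"
    then have "Re (A $ i $ i) \<le> 0" for i using that by (meson not_le)
    then have "A \<bullet> mat 1 \<le> 0" unfolding tr by (intro sum_nonpos)
    then show False using pos by simp
  qed
  have col: "A $ k $ j = A $ i $ j / A $ i $ i * A $ k $ i" for j k
    by (rule pos_semidef_minor(2)[OF A i minor])
  \<comment> \<open>Conjugation turns the relation between columns into one between rows, the form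
    in which the rank is computed.\<close>
  have "A $ j = cnj (A $ i $ j / A $ i $ i) *s A $ i" for j
  proof -
    have h: "cnj (A $ k $ l) = A $ l $ k" for k l
      using herm by (simp add: hermitian_entry)
    have "A $ j $ k = cnj (A $ i $ j / A $ i $ i) * A $ i $ k" for k
      using arg_cong[OF col[of k j], of cnj] by (simp only: complex_cnj_mult h[of k j] h[of k i])
    then show ?thesis by (simp add: vec_eq_iff)
  qed
  then show "rank A = 1" by (rule rank_eq_1_if_rows_multiples[OF nz])
qed

section \<open>Reference processes\<close>

text \<open>Elements of an independent family are nonzero, so each effect has positive trace and can
  be rescaled by the square root of its trace. The traces add up to \<open>tr I = d\<close>.\<close>

lemma MIC_facts:
  fixes H :: "'m::finite \<Rightarrow> complex^'d^'d"
  assumes "MIC H"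
  shows "real CARD('m) = (real CARD('d))\<^sup>2" "hermitian (H i)" "pos_semidef (H i)"
    "(\<Sum>i\<in>UNIV. H i) = mat 1" "inj H" "independent (range H)"
    "span (range H) = {A. hermitian A}" "0 < H i \<bullet> mat 1" "(\<Sum>i\<in>UNIV. H i \<bullet> mat 1) = real CARD('d)"
    "(norm (H i))\<^sup>2 \<le> (H i \<bullet> mat 1)\<^sup>2"
proof -
  show *: "real CARD('m) = (real CARD('d))\<^sup>2" "hermitian (H i)" "pos_semidef (H i)"
    "(\<Sum>i\<in>UNIV. H i) = mat 1" "inj H" "independent (range H)"
    "span (range H) = {A. hermitian A}"
    using assms by (simp_all add: MIC_def pos_semidef_def)
  have "H i \<noteq> 0" using *(6) dependent_zero[of "range H"] by (metis rangeI)
  then show "0 < H i \<bullet> mat 1" by (rule pos_semidef_norm_le_trace(3)[OF *(3)])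
  show "(norm (H i))\<^sup>2 \<le> (H i \<bullet> mat 1)\<^sup>2" by (rule pos_semidef_norm_le_trace(2)[OF *(3)])
  show "(\<Sum>i\<in>UNIV. H i \<bullet> mat 1) = real CARD('d)"
    using norm_mat_1_complex[where 'd = 'd]
    by (simp add: inner_sum_left[symmetric] *(4) power2_norm_eq_inner)
qed

text \<open>Traces of products of Hermitian matrices are real, so the SIC condition can be read off
  a real Gram matrix.\<close>

lemma SIC_iff_inner:
  fixes H :: "'m::finite \<Rightarrow> complex^'d^'d"
  shows "SIC H \<longleftrightarrow> MIC H \<and> (\<forall>i. rank (H i) = 1) \<and>
    (\<forall>i j. H i \<bullet> H j = 1 / (real CARD('d))\<^sup>2 * ((real CARD('d) * (if i = j then 1 else 0) + 1) / (real CARD('d) + 1)))"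
proof -
  have "(trace (H i ** H j) = 1 / of_nat (CARD('d)\<^sup>2) *
        ((of_nat CARD('d) * (if i = j then 1 else 0) + 1) / (of_nat CARD('d) + 1)))
    \<longleftrightarrow> H i \<bullet> H j = 1 / (real CARD('d))\<^sup>2 * ((real CARD('d) * (if i = j then 1 else 0) + 1) / (real CARD('d) + 1))"
    if "MIC H" for i j
  proof -
    have "1 / of_nat (CARD('d)\<^sup>2) *
        ((of_nat CARD('d) * (if i = j then 1 else 0) + 1) / (of_nat CARD('d) + 1))
      = complex_of_real (1 / (real CARD('d))\<^sup>2 * ((real CARD('d) * (if i = j then 1 else 0) + 1) / (real CARD('d) + 1)))"
      by simp
    then show ?thesis
      by (simp only: trace_mult_hermitian[OF MIC_facts(2)[OF that] MIC_facts(2)[OF that]] of_real_eq_iff)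
  qed
  then show ?thesis unfolding SIC_def by blast
qed

section \<open>Gram determinant of the effects\<close>

lemma norm_sqrt_weights:
  fixes w :: "'m::finite \<Rightarrow> real"
  assumes "\<And>i. 0 \<le> w i" "(\<Sum>i\<in>UNIV. w i) = 1"
  shows "norm (\<chi> i. sqrt (w i)) = 1"
  using assms by (simp add: norm_vec_def L2_set_def)

text \<open>Weighted by \<open>v_i = sqrt (h_i / d)\<close>, the rescaled effects sum to
  \<open>I / sqrt d\<close>, so the Rayleigh quotient of \<open>G\<close> at \<open>v\<close> is 1.
  Its trace is at most the sum of the \<open>h_i\<close>, which is \<open>d\<close>. Equality
  prescribes all entries of \<open>G\<close> and makes every effect rank 1.\<close>

lemma MIC_gram_bound:
  fixes H :: "'m::finite \<Rightarrow> complex^'d^'d"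
  assumes H: "MIC H"
  defines "G \<equiv> gram (\<lambda>i. (1 / sqrt (H i \<bullet> mat 1)) *\<^sub>R H i)"
  shows "det G * (real CARD('d) + 1) ^ (CARD('m) - 1) \<le> 1"
    and "det G * (real CARD('d) + 1) ^ (CARD('m) - 1) = 1 \<Longrightarrow> SIC H"
proof -
  note facts = MIC_facts[OF H]
  let ?d = "real CARD('d)"
  define h where "h i = H i \<bullet> mat 1" for i
  define v :: "real^'m" where "v = (\<chi> i. sqrt (h i / ?d))"
  have d: "?d > 0" by simp
  have h: "h i > 0" for i using facts(8) by (simp add: h_def)
  have sum_h: "(\<Sum>i\<in>UNIV. h i) = ?d" using facts(9) by (simp add: h_def)
  have v: "norm v = 1"
    unfolding v_def using h sum_h d
    by (intro norm_sqrt_weights) (simp_all add: less_imp_le sum_divide_distrib[symmetric])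
  have trG: "trace G = (\<Sum>i\<in>UNIV. (norm (H i))\<^sup>2 / h i)"
    unfolding G_def trace_gram h_def[symmetric]
    using h by (simp add: power_divide power_mult_distrib less_imp_le divide_simps)
  have le: "(norm (H i))\<^sup>2 / h i \<le> h i" for i
    using facts(10)[of i] h[of i] by (simp add: h_def[symmetric] divide_simps power2_eq_square)
  have tr: "trace G \<le> ?d"
    unfolding trG sum_h[symmetric] by (intro sum_mono le)
  have "(\<Sum>i\<in>UNIV. v $ i *\<^sub>R (1 / sqrt (h i)) *\<^sub>R H i) = (\<Sum>i\<in>UNIV. (1 / sqrt ?d) *\<^sub>R H i)"
    using h by (intro sum.cong) (simp_all add: v_def real_sqrt_divide less_imp_neq[THEN not_sym])
  also have "\<dots> = (1 / sqrt ?d) *\<^sub>R mat 1"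
    by (simp add: scaleR_sum_right[symmetric] facts(4))
  finally have "v \<bullet> (G *v v) = (1 / ?d) * (norm (mat 1 :: complex^'d^'d))\<^sup>2"
    by (simp add: G_def h_def[symmetric] gram_quadratic_form power_divide)
  then have dir: "v \<bullet> (G *v v) = 1"
    by (simp add: norm_mat_1_complex)
  have psd: "0 \<le> x \<bullet> (G *v x)" and sym: "transpose G = G" for x
    by (simp_all add: G_def gram_quadratic_form)
  note bound = det_bound_trace_direction[OF sym psd v d facts(1)[symmetric] tr eq_refl[OF dir[symmetric]]]
  show "det G * (?d + 1) ^ (CARD('m) - 1) \<le> 1" by (rule bound(1))
  assume "det G * (?d + 1) ^ (CARD('m) - 1) = 1"
  from bound(2)[OF this] have trd: "trace G = ?d"
    and G: "G = scalar_plus_rank_one (1 / (?d + 1)) (?d / (?d + 1)) v" by auto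
  have "(\<Sum>i\<in>UNIV. h i - (norm (H i))\<^sup>2 / h i) = 0"
    using trd sum_h by (simp add: trG sum_subtractf)
  then have "h i - (norm (H i))\<^sup>2 / h i = 0" for i
    using le by (subst (asm) sum_nonneg_eq_0_iff) auto
  then have nrm: "(norm (H i))\<^sup>2 = (h i)\<^sup>2" for i
    using h[of i] by (metis eq_iff_diff_eq_0 less_irrefl nonzero_eq_divide_eq power2_eq_square)
  have ip: "H i \<bullet> H j = (if i = j then h i / (?d + 1) else 0) + h i * h j / (?d + 1)" for i j
  proof -
    have "(H i \<bullet> H j) / (sqrt (h i) * sqrt (h j)) = G $ i $ j"
      by (simp add: G_def gram_def h_def)
    also have "\<dots> = (if i = j then 1 / (?d + 1) else 0) + sqrt (h i) * sqrt (h j) / (?d + 1)"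
      using d by (simp add: G scalar_plus_rank_one_def v_def real_sqrt_divide divide_simps)
    finally have "H i \<bullet> H j = ((if i = j then 1 / (?d + 1) else 0) + sqrt (h i) * sqrt (h j) / (?d + 1)) * (sqrt (h i) * sqrt (h j))"
      using h[of i] h[of j] by (simp add: nonzero_divide_eq_eq)
    then show ?thesis
      using h[of i] h[of j] by (auto simp: algebra_simps less_imp_le)
  qed
  \<comment> \<open>The diagonal entry of \<open>G\<close> and the equality in the norm bound both
    determine the norm of \<open>H i\<close>; equating the two values leaves only
    \<open>h i = 1 / d\<close>.\<close>
  have hi: "h i = 1 / ?d" for i
  proof -
    have "(h i)\<^sup>2 = h i / (?d + 1) + h i * h i / (?d + 1)"
      using ip[of i i] nrm[of i] by (simp add: power2_norm_eq_inner)
    then have "h i * (h i * (?d + 1)) = h i * (1 + h i)"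
      using d by (simp add: add_divide_distrib[symmetric] nonzero_eq_divide_eq power2_eq_square
          algebra_simps)
    then have "h i * (?d + 1) = 1 + h i" using h[of i] by simp
    then show ?thesis using d by (simp add: field_simps)
  qed
  show "SIC H"
    unfolding SIC_iff_inner
  proof (intro conjI allI H)
    fix i j
    have "H i \<noteq> 0" using h[of i] by (auto simp: h_def)
    then show "rank (H i) = 1"
      using nrm[of i] by (intro pos_semidef_norm_le_trace(4)[OF facts(3)]) (simp_all add: h_def)
    show "H i \<bullet> H j = 1 / ?d\<^sup>2 * ((?d * (if i = j then 1 else 0) + 1) / (?d + 1))"
      using d by (simp add: ip hi divide_simps power2_eq_square)
  qed
qed

section \<open>Gram determinant of the states\<close>

lemma density_facts:
  fixes A :: "complex^'d^'d"
  assumes "density_operator A"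
  shows "hermitian A" "pos_semidef A" "A \<bullet> mat 1 = 1" "(norm A)\<^sup>2 \<le> 1" "A \<noteq> 0"
proof -
  show *: "pos_semidef A" and h: "hermitian A"
    using assms by (simp_all add: density_operator_def pos_semidef_def)
  have "complex_of_real (A \<bullet> mat 1) = 1"
    using assms trace_hermitian[OF h] by (simp add: density_operator_def)
  then show t: "A \<bullet> mat 1 = 1" by (simp only: of_real_eq_1_iff)
  then show nz: "A \<noteq> 0" by auto
  show "(norm A)\<^sup>2 \<le> 1" using pos_semidef_norm_le_trace(2)[OF *] by (simp add: t)
qed

lemma scaleR_matrix_vector_mult: "(r *\<^sub>R A) *v v = r *\<^sub>R (A *v v)"
  for A :: "complex^'n^'m"
  by (simp add: matrix_vector_mult_def vec_eq_iff scaleR_sum_right)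

lemma pos_semidef_scaleR: "0 \<le> r \<Longrightarrow> pos_semidef A \<Longrightarrow> pos_semidef (r *\<^sub>R A)"
  by (simp add: pos_semidef_inner hermitian_entry scaleR_matrix_vector_mult)

text \<open>The MIC \<open>H\<close> fixes the dimension of the real space of Hermitian matrices as
  \<open>CARD('m)\<close>, so an independent family of that size spans it.\<close>

lemma MIC_scaleR_states:
  fixes \<sigma> :: "'m::finite \<Rightarrow> complex^'d^'d"
  assumes H: "MIC (H :: 'm \<Rightarrow> complex^'d^'d)"
    and psd: "\<And>j. pos_semidef (\<sigma> j)" and ind: "inj \<sigma>" "independent (range \<sigma>)"
    and r: "r > 0" and sum: "(\<Sum>j\<in>UNIV. r *\<^sub>R \<sigma> j) = mat 1"
  shows "MIC (\<lambda>j. r *\<^sub>R \<sigma> j)"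
proof -
  let ?T = "\<lambda>j. r *\<^sub>R \<sigma> j"
  have inj: "inj ?T" using ind(1) r by (auto simp: inj_def)
  have "independent ((*\<^sub>R) r ` range \<sigma>)"
    by (rule linear_independent_injective_image[OF linear_scaleR ind(2)])
       (use r in \<open>simp add: inj_on_def\<close>)
  then have indT: "independent (range ?T)" by (simp add: image_image)
  have psdT: "pos_semidef (?T j)" for j using psd r by (intro pos_semidef_scaleR) auto
  then have sub: "range ?T \<subseteq> {A. hermitian A}" by (auto simp: pos_semidef_def)
  have "dim {A :: complex^'d^'d. hermitian A} = CARD('m)"
    using MIC_facts(5,6,7)[OF H] by (metis card_image dim_eq_card_independent dim_span)
  moreover have "card (range ?T) = CARD('m)" using inj by (rule card_image)
  ultimately have "{A. hermitian A} \<subseteq> span (range ?T)"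
    using sub indT by (intro card_ge_dim_independent) simp_all
  moreover have "span (range ?T) \<subseteq> {A. hermitian A}"
    using span_mono[OF sub] MIC_facts(7)[OF H] by (metis span_span)
  ultimately show ?thesis
    using H psdT inj indT sum by (auto simp: MIC_def)
qed

text \<open>The direction is the unit vector with all entries \<open>1 / d\<close>, where the
  Rayleigh quotient is \<open>norm \<Sigma>^2 / d^3\<close> for the sum \<open>\<Sigma>\<close> of
  the states. The trace is at most \<open>d\<close> because states have norm at most 1. Equality
  gives \<open>\<Sigma> = d I\<close>, so the states divided by \<open>d\<close> resolve the
  identity.\<close>

lemma states_gram_bound:
  fixes \<sigma> :: "'m::finite \<Rightarrow> complex^'d^'d"
  assumes H: "MIC (H :: 'm \<Rightarrow> complex^'d^'d)"
    and dens: "\<And>j. density_operator (\<sigma> j)" and ind: "inj \<sigma>" "independent (range \<sigma>)"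
  defines "K \<equiv> gram (\<lambda>i. (1 / sqrt (real CARD('d))) *\<^sub>R \<sigma> i)"
  shows "det K * (real CARD('d) + 1) ^ (CARD('m) - 1) \<le> 1"
    and "det K * (real CARD('d) + 1) ^ (CARD('m) - 1) = 1 \<Longrightarrow> SIC_states \<sigma>"
proof -
  let ?d = "real CARD('d)"
  note dens = density_facts[OF dens]
  have N: "real CARD('m) = ?d\<^sup>2" by (rule MIC_facts(1)[OF H])
  define v :: "real^'m" where "v = (\<chi> i. sqrt (1 / ?d\<^sup>2))"
  have d: "?d > 0" by simp
  have v: "norm v = 1"
    unfolding v_def by (intro norm_sqrt_weights) (simp_all add: N)
  have trK: "trace K = (\<Sum>j\<in>UNIV. (norm (\<sigma> j))\<^sup>2 / ?d)"
    unfolding K_def trace_gram by (simp add: power_divide)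
  have "trace K \<le> (\<Sum>j\<in>(UNIV::'m set). 1 / ?d)"
    unfolding trK using dens(4) by (intro sum_mono divide_right_mono) auto
  also have sum1: "(\<Sum>j\<in>(UNIV::'m set). 1 / ?d) = ?d"
    by (simp add: N power2_eq_square)
  finally have tr: "trace K \<le> ?d" .
  define \<Sigma> where "\<Sigma> = (\<Sum>j\<in>UNIV. \<sigma> j)"
  have S1: "\<Sigma> \<bullet> mat 1 = ?d\<^sup>2"
    by (simp add: \<Sigma>_def inner_sum_left dens(3) N)
  have "(\<Sum>i\<in>UNIV. v $ i *\<^sub>R (1 / sqrt ?d) *\<^sub>R \<sigma> i) = (1 / (?d * sqrt ?d)) *\<^sub>R \<Sigma>"
    by (simp add: v_def \<Sigma>_def scaleR_sum_right real_sqrt_divide)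
  then have dir_eq: "v \<bullet> (K *v v) = (norm \<Sigma>)\<^sup>2 / ?d ^ 3"
    by (simp add: K_def gram_quadratic_form power_divide power_mult_distrib power3_eq_cube power2_eq_square)
  \<comment> \<open>Expanding the squared distance of \<open>\<Sigma>\<close> from
    \<open>d I\<close>, with \<open>tr \<Sigma> = d^2\<close>, yields both the bound
    \<open>d^3 \<le> norm \<Sigma>^2\<close> and its equality case.\<close>
  have "(norm (\<Sigma> - ?d *\<^sub>R mat 1))\<^sup>2 = (norm \<Sigma>)\<^sup>2 - 2 * ?d * (\<Sigma> \<bullet> mat 1) + ?d\<^sup>2 * (norm (mat 1 :: complex^'d^'d))\<^sup>2"
    unfolding power2_norm_eq_inner
    by (simp add: inner_diff_left inner_diff_right inner_commute[of "mat 1" \<Sigma>]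
        algebra_simps power2_eq_square)
  then have dist: "(norm (\<Sigma> - ?d *\<^sub>R mat 1))\<^sup>2 = (norm \<Sigma>)\<^sup>2 - ?d ^ 3"
    unfolding S1 norm_mat_1_complex by (simp add: power3_eq_cube power2_eq_square)
  then have "?d ^ 3 \<le> (norm \<Sigma>)\<^sup>2" by (metis diff_ge_0_iff_ge zero_le_power2)
  then have dir: "v \<bullet> (K *v v) \<ge> 1" by (simp add: dir_eq)
  have psd: "0 \<le> x \<bullet> (K *v x)" and sym: "transpose K = K" for x
    by (simp_all add: K_def gram_quadratic_form)
  note bound = det_bound_trace_direction[OF sym psd v d N[symmetric] tr dir]
  show "det K * (?d + 1) ^ (CARD('m) - 1) \<le> 1" by (rule bound(1))
  assume "det K * (?d + 1) ^ (CARD('m) - 1) = 1"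
  from bound(2)[OF this] have trd: "trace K = ?d" and dir1: "v \<bullet> (K *v v) = 1"
    and K: "K = scalar_plus_rank_one (1 / (?d + 1)) (?d / (?d + 1)) v" by auto
  have "(norm \<Sigma>)\<^sup>2 = ?d ^ 3" using dir1 d by (simp add: dir_eq)
  then have "\<Sigma> = ?d *\<^sub>R mat 1" using dist by simp
  then have sum: "(\<Sum>j\<in>UNIV. (1 / ?d) *\<^sub>R \<sigma> j) = mat 1"
    by (simp add: \<Sigma>_def scaleR_sum_right[symmetric])
  have "(\<Sum>j\<in>UNIV. 1 / ?d - (norm (\<sigma> j))\<^sup>2 / ?d) = 0"
    unfolding sum_subtractf sum1 using trd by (simp add: trK)
  then have "1 / ?d - (norm (\<sigma> j))\<^sup>2 / ?d = 0" for j
    using dens(4) by (subst (asm) sum_nonneg_eq_0_iff) (auto simp: divide_right_mono)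
  then have nrm: "(norm (\<sigma> j))\<^sup>2 = 1" for j
    using d by (simp add: divide_simps)
  have ip: "\<sigma> i \<bullet> \<sigma> j = ?d * K $ i $ j" for i j
    by (simp add: K_def gram_def)
  show "SIC_states \<sigma>"
    unfolding SIC_states_def SIC_iff_inner
  proof (intro conjI allI)
    show "MIC (\<lambda>j. (1 / ?d) *\<^sub>R \<sigma> j)"
      by (rule MIC_scaleR_states[OF H dens(2) ind _ sum]) simp
    fix i j
    show "rank ((1 / ?d) *\<^sub>R \<sigma> i) = 1"
      using nrm[of i] dens(2,3,5)[of i]
      by (intro pos_semidef_norm_le_trace(4) pos_semidef_scaleR) (simp_all add: power_divide)
    show "(1 / ?d) *\<^sub>R \<sigma> i \<bullet> (1 / ?d) *\<^sub>R \<sigma> j = 1 / ?d\<^sup>2 * ((?d * (if i = j then 1 else 0) + 1) / (?d + 1))"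
      using d by (simp add: ip K scalar_plus_rank_one_def v_def real_sqrt_divide divide_simps)
        (simp add: algebra_simps power2_eq_square)
  qed
qed

section \<open>Determinant bound for the outcome matrix\<close>

lemma outcome_matrix_inner:
  assumes "\<And>i. hermitian (H i)" "\<And>j. hermitian (\<sigma> j)"
  shows "outcome_matrix H \<sigma> = (\<chi> i j. H i \<bullet> \<sigma> j)"
  by (simp add: outcome_matrix_def trace_mult_hermitian[OF assms])

text \<open>The square of the left-hand side factors as \<open>p * (x * y)\<close>: \<open>x\<close>
  and \<open>y\<close> are the normalized Gram determinants of effects and states, and
  \<open>p\<close>, the product of the \<open>d * h i\<close>, absorbs the rescalings. All three lie
  between 0 and 1, so the value 1 forces \<open>x = y = 1\<close>.\<close>

lemma det_outcome_matrix_bound: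
  fixes H \<sigma> :: "'m::finite \<Rightarrow> complex^'d^'d"
  assumes "reference_process H \<sigma>"
  shows "\<bar>det (outcome_matrix H \<sigma>)\<bar> * (real CARD('d) + 1) ^ (CARD('m) - 1) \<le> 1"
    and "\<bar>det (outcome_matrix H \<sigma>)\<bar> * (real CARD('d) + 1) ^ (CARD('m) - 1) = 1
      \<Longrightarrow> SIC H \<and> SIC_states \<sigma>"
proof -
  let ?d = "real CARD('d)"
  let ?c = "(real CARD('d) + 1) ^ (CARD('m) - 1)"
  have H: "MIC H" and dens: "\<And>j. density_operator (\<sigma> j)" and ind: "inj \<sigma>" "independent (range \<sigma>)"
    using assms by (auto simp: reference_process_def)
  note facts = MIC_facts[OF H]
  have herm: "hermitian (\<sigma> j)" for j by (rule density_facts(1)[OF dens])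
  define h where "h i = H i \<bullet> mat 1" for i
  have h: "h i > 0" for i using facts(8) by (simp add: h_def)
  define x where "x = det (gram (\<lambda>i. (1 / sqrt (h i)) *\<^sub>R H i)) * ?c"
  define y where "y = det (gram (\<lambda>i. (1 / sqrt ?d) *\<^sub>R \<sigma> i)) * ?c"
  define p where "p = (\<Prod>i\<in>UNIV. ?d * h i)"
  have x: "x \<le> 1" "x = 1 \<Longrightarrow> SIC H"
    using MIC_gram_bound[OF H] by (simp_all add: x_def h_def)
  have y: "y \<le> 1" "y = 1 \<Longrightarrow> SIC_states \<sigma>"
    using states_gram_bound[OF H dens ind] by (simp_all add: y_def)
  have nn: "0 \<le> x" "0 \<le> y"
    unfolding x_def y_def by (intro mult_nonneg_nonneg det_gram_nonneg; simp)+
  have p: "0 \<le> p" "p \<le> 1"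
  proof -
    have "(\<Sum>i\<in>UNIV. ?d * h i) \<le> real CARD('m)"
      using facts(9) by (simp add: sum_distrib_left[symmetric] h_def facts(1) power2_eq_square)
    then show "p \<le> 1" unfolding p_def
      using h by (intro prod_le_1_if_sum_le_card(1)) (auto simp: less_imp_le)
    show "0 \<le> p" unfolding p_def using h by (intro prod_nonneg) (simp add: less_imp_le)
  qed
  have sq: "(det (outcome_matrix H \<sigma>))\<^sup>2 = det (gram H) * det (gram \<sigma>)"
    unfolding outcome_matrix_inner[OF facts(2) herm]
    using herm facts(5,7) by (intro det_cross_gram_square) auto
  have gH: "det (gram (\<lambda>i. (1 / sqrt (h i)) *\<^sub>R H i)) * (\<Prod>i\<in>UNIV. h i) = det (gram H)"
  proof -
    have "(\<Prod>i\<in>UNIV. 1 / sqrt (h i))\<^sup>2 * (\<Prod>i\<in>UNIV. h i) = 1"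
      unfolding prod_power_distrib prod.distrib[symmetric]
      using h by (intro prod.neutral) (simp add: power_divide less_imp_le less_imp_neq[THEN not_sym])
    then show ?thesis by (simp add: det_gram_scaleR mult_ac)
  qed
  have gS: "det (gram (\<lambda>i. (1 / sqrt ?d) *\<^sub>R \<sigma> i)) * ?d ^ CARD('m) = det (gram \<sigma>)"
    by (simp add: det_gram_scaleR power_divide power_mult[symmetric] mult.commute[of "CARD('m)"])
      (simp add: power_mult)
  have p_eq: "p = ?d ^ CARD('m) * (\<Prod>i\<in>UNIV. h i)"
    by (simp add: p_def prod.distrib)
  have "(\<bar>det (outcome_matrix H \<sigma>)\<bar> * ?c)\<^sup>2 = p * (x * y)"
    unfolding power_mult_distrib power2_abs sq gH[symmetric] gS[symmetric] p_eq x_def y_def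
    by (simp add: power2_eq_square mult_ac)
  moreover have xy: "x * y \<le> 1" "0 \<le> x * y" using x y nn by (simp_all add: mult_le_one)
  moreover have "p * (x * y) \<le> x * y" using p xy by (simp add: mult_left_le_one_le)
  ultimately have le_xy: "(\<bar>det (outcome_matrix H \<sigma>)\<bar> * ?c)\<^sup>2 \<le> x * y" by simp
  then have "(\<bar>det (outcome_matrix H \<sigma>)\<bar> * ?c)\<^sup>2 \<le> 1\<^sup>2" using xy by simp
  then show "\<bar>det (outcome_matrix H \<sigma>)\<bar> * ?c \<le> 1" by (rule power2_le_imp_le) simp
  assume "\<bar>det (outcome_matrix H \<sigma>)\<bar> * ?c = 1"
  then have "1 \<le> x * y" using le_xy by simp
  moreover have "x * y \<le> x" "x * y \<le> y" using x y nn by (simp_all add: mult_left_le mult_left_le_one_le)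
  ultimately show "SIC H \<and> SIC_states \<sigma>" using x y by fastforce
qed

section \<open>Reference processes built from two SICs\<close>

lemma norm_const_vec: "real CARD('m) = (real CARD('d::finite))\<^sup>2
    \<Longrightarrow> norm (\<chi> i. 1 / real CARD('d) :: real^'m) = 1"
  using norm_sqrt_weights[of "\<lambda>i::'m::finite. 1 / (real CARD('d))\<^sup>2"]
  by (simp add: real_sqrt_divide)

text \<open>The change of basis matrix between two SICs has all row and column sums 1, so it commutes
  with their common Gram matrix and is therefore orthogonal.\<close>

lemma SIC_outcome_matrix_normal:
  fixes H \<sigma> :: "'m::finite \<Rightarrow> complex^'d^'d"
  assumes H: "SIC H" and \<sigma>: "SIC_states \<sigma>"
  defines "A \<equiv> outcome_matrix H \<sigma>"
    and "B \<equiv> scalar_plus_rank_one (1 / (real CARD('d) + 1)) (real CARD('d) / (real CARD('d) + 1))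
      (\<chi> i. 1 / real CARD('d))"
  shows "A ** transpose A = B ** B" "transpose A ** A = B ** B"
proof -
  let ?d = "real CARD('d)"
  define T where "T j = (1 / ?d) *\<^sub>R \<sigma> j" for j
  have d: "?d > 0" by simp
  have T: "SIC T" using \<sigma> by (simp add: SIC_states_def T_def[abs_def])
  have MH: "MIC H" and MT: "MIC T" using H T by (simp_all add: SIC_def)
  note fH = MIC_facts[OF MH] and fT = MIC_facts[OF MT]
  \<comment> \<open>All SICs in one dimension share their Gram matrix; the scaling by
    \<open>d\<close> matches the factor in \<open>\<sigma> j = d T j\<close>.\<close>
  have gram_SIC: "?d *\<^sub>R gram X = B" if "SIC X" for X :: "'m \<Rightarrow> complex^'d^'d"
  proof -
    have ip: "X i \<bullet> X j = 1 / ?d\<^sup>2 * ((?d * (if i = j then 1 else 0) + 1) / (?d + 1))" for i j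
      using that by (simp add: SIC_iff_inner)
    have "?d * (X i \<bullet> X j) = B $ i $ j" for i j
      using d unfolding ip by (simp add: B_def scalar_plus_rank_one_def divide_simps power2_eq_square)
    then show ?thesis by (simp add: vec_eq_iff gram_def)
  qed
  have unit: "norm (\<chi> i. 1 / ?d :: real^'m) = 1"
    by (rule norm_const_vec[OF fH(1)])
  obtain C where C: "\<And>j. T j = (\<Sum>k\<in>UNIV. C $ k $ j *\<^sub>R H k)"
    "(\<chi> i j. H i \<bullet> T j) = gram H ** C" "gram T = transpose C ** gram H ** C"
    using change_of_basis_matrix[of H T] fH(5,7) fT(2) by (metis (mono_tags) image_subsetI mem_Collect_eq)
  have A: "A = B ** C"
  proof -
    have "hermitian (\<sigma> j)" for j
      using fT(2)[of j] by (simp add: hermitian_entry T_def)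
    then have "A = (\<chi> i j. H i \<bullet> \<sigma> j)"
      unfolding A_def by (intro outcome_matrix_inner fH(2))
    also have "\<dots> = ?d *\<^sub>R (\<chi> i j. H i \<bullet> T j)"
      by (simp add: vec_eq_iff T_def)
    also have "\<dots> = (?d *\<^sub>R gram H) ** C"
      unfolding C(2) by (simp add: scalar_matrix_assoc)
    finally show ?thesis by (simp add: gram_SIC[OF H])
  qed
  have BC: "B = transpose C ** B ** C"
  proof -
    have "?d *\<^sub>R gram T = transpose C ** (?d *\<^sub>R gram H) ** C"
      unfolding C(3) by (simp add: scalar_matrix_assoc matrix_scalar_ac)
    then show ?thesis by (simp add: gram_SIC[OF H] gram_SIC[OF T])
  qed
  \<comment> \<open>Both families sum to the identity, and independence of \<open>H\<close> lets the
    coefficients be compared.\<close>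
  have rows: "(\<Sum>j\<in>UNIV. C $ k $ j) = 1" for k
  proof -
    have "(\<Sum>k\<in>UNIV. (\<Sum>j\<in>UNIV. C $ k $ j) *\<^sub>R H k) = (\<Sum>j\<in>UNIV. T j)"
      unfolding C(1) scaleR_sum_left by (rule sum.swap)
    then have "(\<Sum>k\<in>UNIV. ((\<Sum>j\<in>UNIV. C $ k $ j) - 1) *\<^sub>R H k) = 0"
      by (simp add: fT(4) fH(4) scaleR_diff_left sum_subtractf)
    from independent_range_coeff_0[OF fH(5,6) this, of k] show ?thesis by simp
  qed
  have tr: "X k \<bullet> mat 1 = 1 / ?d" if "SIC X" for X :: "'m \<Rightarrow> complex^'d^'d" and k
  proof -
    have M: "MIC X" using that by (simp add: SIC_def)
    have "X k \<bullet> mat 1 = (\<Sum>j\<in>UNIV. X k \<bullet> X j)"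
      by (simp add: MIC_facts(4)[OF M, symmetric] inner_sum_right)
    also have "\<dots> = (\<Sum>j\<in>UNIV. (if k = j then 1 / (?d * (?d + 1)) else 0) + 1 / (?d\<^sup>2 * (?d + 1)))"
      using that d by (intro sum.cong) (auto simp: SIC_iff_inner divide_simps power2_eq_square)
    also have "\<dots> = 1 / (?d * (?d + 1)) + ?d\<^sup>2 / (?d\<^sup>2 * (?d + 1))"
      by (simp add: sum.distrib fH(1))
    also have "\<dots> = 1 / ?d" using d by (simp add: divide_simps)
    finally show ?thesis .
  qed
  \<comment> \<open>Traces are taken in the expansion of \<open>T j\<close>, all SIC elements having
    trace \<open>1 / d\<close>.\<close>
  have cols: "(\<Sum>k\<in>UNIV. C $ k $ j) = 1" for j
  proof -
    have "T j \<bullet> mat 1 = (\<Sum>k\<in>UNIV. C $ k $ j) * (1 / ?d)"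
      unfolding C(1) by (simp add: inner_sum_left tr[OF H] sum_divide_distrib)
    then show ?thesis using tr[OF T, of j] by simp
  qed
  \<comment> \<open>\<open>B\<close> is a multiple of the identity plus a constant matrix, and the
    latter commutes with \<open>C\<close> because all row and column sums of \<open>C\<close> are
    1.\<close>
  have comm: "B ** C = C ** B"
  proof -
    have "(B ** C) $ i $ j = 1 / (?d + 1) * C $ i $ j + 1 / (?d * (?d + 1)) * (\<Sum>k\<in>UNIV. C $ k $ j)" for i j
    proof -
      have "(B ** C) $ i $ j = (\<Sum>k\<in>UNIV. (if i = k then 1 / (?d + 1) * C $ k $ j else 0) + 1 / (?d * (?d + 1)) * C $ k $ j)"
        using d unfolding matrix_matrix_mult_def B_def scalar_plus_rank_one_def
        by (auto intro!: sum.cong simp: divide_simps) (simp add: algebra_simps)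
      then show ?thesis by (simp add: sum.distrib sum_distrib_left)
    qed
    moreover have "(C ** B) $ i $ j = 1 / (?d + 1) * C $ i $ j + 1 / (?d * (?d + 1)) * (\<Sum>k\<in>UNIV. C $ i $ k)" for i j
    proof -
      have "(C ** B) $ i $ j = (\<Sum>k\<in>UNIV. (if k = j then 1 / (?d + 1) * C $ i $ k else 0) + 1 / (?d * (?d + 1)) * C $ i $ k)"
        using d unfolding matrix_matrix_mult_def B_def scalar_plus_rank_one_def
        by (auto intro!: sum.cong simp: divide_simps) (simp add: algebra_simps)
      then show ?thesis by (simp add: sum.distrib sum_distrib_left)
    qed
    ultimately show ?thesis by (simp add: vec_eq_iff rows cols)
  qed
  define R where "R = scalar_plus_rank_one (?d + 1) (- ?d) (\<chi> i. 1 / ?d :: real^'m)"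
  have BR: "B ** R = mat 1"
    using d by (simp add: B_def R_def scalar_plus_rank_one_mult[OF unit] divide_simps)
      (simp add: scalar_plus_rank_one_1_0)
  \<comment> \<open>Moving \<open>B\<close> past \<open>C\<close> in \<open>BC\<close> gives this
    equation; cancelling the invertible \<open>B\<close> then shows that \<open>C\<close> is
    orthogonal.\<close>
  have "transpose C ** C ** B = B"
    using BC comm by (metis matrix_mul_assoc)
  then have "transpose C ** C ** (B ** R) = B ** R" by (metis matrix_mul_assoc)
  then have CC: "transpose C ** C = mat 1" by (simp add: BR)
  then have CC': "C ** transpose C = mat 1" using matrix_left_right_inverse by blast
  have tB: "transpose B = B" by (simp add: B_def)
  have "A ** transpose A = B ** (C ** transpose C) ** B"
    by (simp add: A matrix_transpose_mul tB matrix_mul_assoc)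
  then show "A ** transpose A = B ** B" by (simp add: CC')
  have "transpose A ** A = (transpose C ** B) ** (C ** B)"
    by (simp add: A matrix_transpose_mul tB flip: comm)
  also have "\<dots> = (transpose C ** B ** C) ** B" by (simp only: matrix_mul_assoc)
  finally show "transpose A ** A = B ** B" by (simp add: BC[symmetric])
qed

section \<open>Singular values\<close>

text \<open>The last entry is the smallest. If it is at most \<open>c\<close>, the remaining entries
  still satisfy the product bound and induction applies; otherwise every entry exceeds
  \<open>c\<close>.\<close>

lemma prod_list_take_ge_power:
  fixes xs :: "real list"
  assumes "sorted (rev xs)" "\<And>x. x \<in> set xs \<Longrightarrow> 0 \<le> x" "c > 0" "c ^ length xs \<le> prod_list xs" "k \<le> length xs"
  shows "c ^ k \<le> prod_list (take k xs)"
  using assms(1,2,4,5)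
proof (induction xs rule: rev_induct)
  case (snoc x xs)
  show ?case
  proof (cases "k = length (xs @ [x])")
    case False
    then have k: "k \<le> length xs" using snoc.prems(4) by simp
    have ge: "x \<le> y" if "y \<in> set xs" for y using snoc.prems(1) that by simp
    have take: "take k (xs @ [x]) = take k xs" using k by simp
    show ?thesis
    proof (cases "x \<le> c")
      case True
      have "c ^ length xs * c \<le> prod_list xs * x" using snoc.prems(3) by (simp add: mult.commute)
      also have "\<dots> \<le> prod_list xs * c"
        using True snoc.prems(2) by (intro mult_left_mono prod_list_nonneg) auto
      finally have "c ^ length xs \<le> prod_list xs" using assms(3) by simp
      then show ?thesis unfolding take using snoc k by simp
    next
      case x: False
      have "c ^ length ys \<le> prod_list ys" if "set ys \<subseteq> set xs" for ys
        using that
      proof (induction ys)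
        case (Cons y ys)
        then have "c \<le> y" "c ^ length ys \<le> prod_list ys" using x ge[of y] by auto
        then show ?case using assms(3) by (simp add: mult_mono)
      qed simp
      from this[of "take k xs"] show ?thesis unfolding take using k by (simp add: set_take_subset min.absorb2)
    qed
  qed (use snoc.prems in simp)
qed simp

lemma singular_values_decomposition:
  fixes A :: "real^'n^'n"
  obtains Q e where "orthogonal_matrix Q" "transpose A ** A = transpose Q ** diag_mat e ** Q"
    "\<And>i. e i \<ge> 0" "mset (singular_values A) = image_mset (\<lambda>i. sqrt (e i)) (mset_set UNIV)"
proof -
  have "0 \<le> x \<bullet> ((transpose A ** A) *v x)" for x
    using conj_quadratic_form[of x A "mat 1"] by simp
  moreover have "transpose (transpose A ** A) = transpose A ** A"
    by (simp add: matrix_transpose_mul)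
  ultimately obtain Q e where "orthogonal_matrix Q" "transpose A ** A = transpose Q ** diag_mat e ** Q"
    "\<And>i. e i \<ge> 0"
    using psd_matrix_diagonalization by blast
  then show thesis using that mset_singular_values by blast
qed

lemma length_singular_values: "length (singular_values (A :: real^'n^'n)) = CARD('n)"
  by (rule singular_values_decomposition[of A]) (metis size_mset size_image_mset size_mset_set)

lemma sorted_rev_singular_values: "sorted (rev (singular_values A))"
  by (simp add: singular_values_def)

lemma decreasing_singular_values: "decreasing (singular_values A) = singular_values A"
proof -
  have "sort (singular_values A) = rev (singular_values A)"
    using sorted_rev_singular_values[of A] by (intro properties_for_sort) simp
  then show ?thesis by (simp add: decreasing_def)
qed

lemma singular_values_nonneg: "x \<in> set (singular_values A) \<Longrightarrow> 0 \<le> x"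
  by (rule singular_values_decomposition[of A])
     (metis (no_types, lifting) set_mset_mset set_image_mset imageE real_sqrt_ge_zero)

text \<open>The squared singular values are the eigenvalues of \<open>transpose A ** A\<close>,
  whose product is \<open>(det A)^2\<close>.\<close>

lemma prod_singular_values: "prod_list (singular_values A) = \<bar>det A\<bar>"
proof -
  obtain Q e where Q: "orthogonal_matrix Q" "transpose A ** A = transpose Q ** diag_mat e ** Q"
    "\<And>i. e i \<ge> 0" "mset (singular_values A) = image_mset (\<lambda>i. sqrt (e i)) (mset_set UNIV)"
    using singular_values_decomposition[of A] by blast
  have "prod_list (singular_values A) = (\<Prod>i\<in>UNIV. sqrt (e i))"
    by (simp add: prod_mset_prod_list[symmetric] Q(4) prod_unfold_prod_mset)
  also have "\<dots> = sqrt (\<Prod>i\<in>UNIV. e i)"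
    by (induction rule: infinite_finite_induct) (simp_all add: real_sqrt_mult)
  also have "(\<Prod>i\<in>UNIV. e i) = det (transpose A ** A)"
    by (simp add: Q(2) det_conj_orthogonal[OF Q(1)] det_diag_mat)
  finally show ?thesis by (simp add: det_mul real_sqrt_mult_self)
qed

text \<open>If all singular values exceeded 1, then \<open>A\<close> would strictly lengthen every
  nonzero vector: in the coordinates \<open>y = Q *v x\<close> the squared length of the image is
  the sum of the \<open>e i * y_i^2\<close>.\<close>

lemma ex_singular_value_le_1:
  fixes A :: "real^'n^'n"
  assumes x: "x \<noteq> 0" "norm (A *v x) \<le> norm x"
  shows "\<exists>s\<in>set (singular_values A). s \<le> 1"
proof (rule ccontr)
  assume neg: "\<not> ?thesis"
  obtain Q e where Q: "orthogonal_matrix Q" "transpose A ** A = transpose Q ** diag_mat e ** Q"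
    "\<And>i. e i \<ge> 0" "mset (singular_values A) = image_mset (\<lambda>i. sqrt (e i)) (mset_set UNIV)"
    using singular_values_decomposition[of A] by blast
  have "set (singular_values A) = range (\<lambda>i. sqrt (e i))"
    using arg_cong[OF Q(4), of set_mset] by simp
  then have e: "e i > 1" for i using neg by (auto simp: not_le)
  define y where "y = Q *v x"
  have "(norm (A *v x))\<^sup>2 = x \<bullet> ((transpose A ** A) *v x)"
    using conj_quadratic_form[of x A "mat 1"] by (simp add: power2_norm_eq_inner)
  also have "\<dots> = y \<bullet> (diag_mat e *v y)"
    unfolding Q(2) y_def by (rule conj_quadratic_form)
  also have "\<dots> = (\<Sum>i\<in>UNIV. e i * (y $ i)\<^sup>2)"
    by (simp add: inner_vec_def matrix_vector_mult_def diag_mat_def power2_eq_square mult_ac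
        if_distrib[of "\<lambda>z. _ * z"] cong: if_cong)
  finally have nA: "(norm (A *v x))\<^sup>2 = (\<Sum>i\<in>UNIV. e i * (y $ i)\<^sup>2)" .
  have "(norm x)\<^sup>2 = x \<bullet> ((transpose Q ** mat 1 ** Q) *v x)"
    using Q(1) by (simp add: orthogonal_matrix power2_norm_eq_inner)
  also have "\<dots> = y \<bullet> y"
    unfolding conj_quadratic_form y_def by simp
  finally have nx: "(norm x)\<^sup>2 = (\<Sum>i\<in>UNIV. (y $ i)\<^sup>2)"
    by (simp add: inner_vec_def power2_eq_square)
  have "(\<Sum>i\<in>UNIV. e i * (y $ i)\<^sup>2) \<le> (\<Sum>i\<in>UNIV. (y $ i)\<^sup>2)"
    using power_mono[OF x(2), of 2] by (simp add: nA nx)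
  then have "(\<Sum>i\<in>UNIV. (e i - 1) * (y $ i)\<^sup>2) \<le> 0"
    by (simp add: left_diff_distrib sum_subtractf)
  moreover have nn: "0 \<le> (e i - 1) * (y $ i)\<^sup>2" for i
    using e[of i] by simp
  ultimately have "(\<Sum>i\<in>UNIV. (e i - 1) * (y $ i)\<^sup>2) = 0"
    by (intro order_antisym sum_nonneg)
  then have "(e i - 1) * (y $ i)\<^sup>2 = 0" for i
    using nn by (subst (asm) sum_nonneg_eq_0_iff) auto
  then have "y $ i = 0" for i using e[of i] by (metis less_irrefl mult_eq_0_iff power2_eq_square right_minus_eq)
  then have "(norm x)\<^sup>2 = 0" unfolding nx by simp
  then show False using x(1) by simp
qed

text \<open>The matrix is symmetric with eigenvalue 1 along \<open>v\<close> and \<open>c\<close> on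
  the complement; as \<open>c\<close> is at least 1, the value 1 comes last.\<close>

lemma singular_values_scalar_plus_rank_one:
  fixes v :: "real^'n"
  assumes v: "norm v = 1" and c: "1 \<le> c"
  shows "singular_values (scalar_plus_rank_one c (1 - c) v) = replicate (CARD('n) - 1) c @ [1]"
proof -
  fix k :: 'n
  let ?W = "scalar_plus_rank_one c (1 - c) v"
  obtain Q where Q: "orthogonal_matrix Q"
    "\<And>a b. scalar_plus_rank_one a b v = transpose Q ** diag_mat (\<lambda>i. if i = k then a + b else a) ** Q"
    using scalar_plus_rank_one_diagonalization[OF v, where k = k] by blast
  have "transpose ?W ** ?W = scalar_plus_rank_one (c * c) (1 - c * c) v"
    by (simp add: scalar_plus_rank_one_mult[OF v])
  also have "\<dots> = transpose Q ** diag_mat (\<lambda>i. if i = k then 1 else c * c) ** Q"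
    using Q(2)[of "c * c" "1 - c * c"] by (simp only: add_diff_cancel_left' add_diff_eq)
  finally have "transpose ?W ** ?W = transpose Q ** diag_mat (\<lambda>i. if i = k then 1 else c * c) ** Q" .
  from mset_singular_values[OF Q(1) this]
  have "mset (singular_values ?W) = image_mset (\<lambda>i. sqrt (if i = k then 1 else c * c)) (mset_set UNIV)" .
  also have "\<dots> = image_mset (\<lambda>i. if i = k then 1 else c) (mset_set UNIV)"
    using c by (intro image_mset_cong) auto
  also have "(UNIV :: 'n set) = insert k (UNIV - {k})" by auto
  also have "mset_set (insert k (UNIV - {k})) = add_mset k (mset_set (UNIV - {k}))"
    by (rule mset_set.insert) auto
  also have "image_mset (\<lambda>i. if i = k then 1 else c) (add_mset k (mset_set (UNIV - {k})))
    = add_mset 1 (image_mset (\<lambda>i. c) (mset_set (UNIV - {k})))"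
    by (auto intro!: image_mset_cong)
  also have "image_mset (\<lambda>i. c) (mset_set (UNIV - {k})) = replicate_mset (CARD('n) - 1) c"
    by (simp add: image_mset_const_eq card_Diff_singleton)
  finally have "mset (rev (singular_values ?W)) = mset (1 # replicate (CARD('n) - 1) c)" by simp
  moreover have "sorted (1 # replicate (CARD('n) - 1) c)" using c by (simp add: sorted_replicate)
  ultimately have "rev (singular_values ?W) = 1 # replicate (CARD('n) - 1) c"
    using sorted_rev_singular_values[of ?W] by (metis properties_for_sort)
  then show ?thesis by (metis rev.simps(2) rev_replicate rev_rev_ident)
qed

text \<open>The smallest entry is at most 1, so the other \<open>n\<close> entries already have
  product at least \<open>c ^ n\<close>, which controls their prefixes. For the whole list the bound
  is the hypothesis on its product.\<close>

lemma weakly_log_majorizes_replicate: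
  fixes xs :: "real list"
  assumes dec: "decreasing xs = xs" and nn: "\<And>x. x \<in> set xs \<Longrightarrow> 0 \<le> x" and c: "1 \<le> c"
    and len: "length xs = Suc n" and prod: "c ^ n \<le> prod_list xs" and ex: "\<exists>s\<in>set xs. s \<le> 1"
  shows "weakly_log_majorizes xs (replicate n c @ [1])"
proof -
  have sorted: "sorted (rev xs)" using dec by (metis decreasing_def rev_rev_ident sorted_sort)
  have dec2: "decreasing (replicate n c @ [1]) = replicate n c @ [1]"
  proof -
    have "sort (replicate n c @ [1]) = 1 # replicate n c"
      using c by (intro properties_for_sort) (auto simp: sorted_replicate)
    then show ?thesis by (simp add: decreasing_def)
  qed
  obtain ys l where xs: "xs = ys @ [l]" and lys: "length ys = n"
    using len by (cases xs rule: rev_cases) auto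
  have "l \<le> 1" using ex sorted xs by auto
  then have "prod_list ys * l \<le> prod_list ys * 1"
    using nn xs by (intro mult_left_mono prod_list_nonneg) auto
  then have "c ^ length ys \<le> prod_list ys" using prod xs lys by simp
  then have ys: "c ^ k \<le> prod_list (take k ys)" if "k \<le> n" for k
    using that sorted nn c by (intro prod_list_take_ge_power) (auto simp: xs lys)
  have "prod_list (take k (replicate n c @ [1])) \<le> prod_list (take k xs)" if "k \<le> Suc n" for k
  proof (cases "k \<le> n")
    case True
    then show ?thesis using ys[OF True] lys by (simp add: xs min_def)
  next
    case False
    then have "k = Suc n" using that by simp
    then show ?thesis using prod len by simp
  qed
  then show ?thesis using len by (simp add: weakly_log_majorizes_def dec dec2)
qed

section \<open>Comparison with the SIC reference process\<close>

lemma born_matrix_SIC_eq: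
  fixes S :: "'m::finite \<Rightarrow> complex^'d^'d"
  assumes "SIC S"
  shows "born_matrix S (\<lambda>i. real CARD('d) *\<^sub>R S i)
    = scalar_plus_rank_one (real CARD('d) + 1) (- real CARD('d)) (\<chi> i. 1 / real CARD('d))"
  unfolding born_matrix_SIC[OF assms] scalar_plus_rank_one_def
  by (simp add: vec_eq_iff)

theorem lemma2:
  fixes S H \<sigma> :: "'m::finite \<Rightarrow> complex^'d::finite^'d"
    and \<Phi> \<Phi>_SIC :: "real^'m^'m"
  assumes "SIC S"
    and "\<Phi>_SIC = born_matrix S (\<lambda>i. real CARD('d) *\<^sub>R S i)"
    and "reference_process H \<sigma>"
    and "\<Phi> = born_matrix H \<sigma>"
  shows "\<bar>det \<Phi>\<bar> \<ge> det \<Phi>_SIC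
    \<and> (\<bar>det \<Phi>\<bar> = det \<Phi>_SIC \<longleftrightarrow> SIC H \<and> SIC_states \<sigma>)
    \<and> weakly_log_majorizes (singular_values \<Phi>) (singular_values \<Phi>_SIC)
    \<and> (singular_values \<Phi> = singular_values \<Phi>_SIC \<longleftrightarrow> SIC H \<and> SIC_states \<sigma>)
    \<and> (SIC H \<and> SIC_states \<sigma> \<longrightarrow>
           transpose \<Phi> ** \<Phi> = \<Phi>_SIC ** \<Phi>_SIC \<and>
           \<Phi> ** transpose \<Phi> = \<Phi>_SIC ** \<Phi>_SIC)"
proof -
  let ?d = "real CARD('d)"
  let ?c = "(?d + 1) ^ (CARD('m) - 1)"
  let ?v = "\<chi> i. 1 / ?d :: real^'m"
  define A where "A = outcome_matrix H \<sigma>"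
  have H: "MIC H" using assms(3) by (simp add: reference_process_def)
  have v: "norm ?v = 1" by (rule norm_const_vec[OF MIC_facts(1)[OF H]])
  \<comment> \<open>The rank-one coefficient \<open>- d\<close> is written as
    \<open>1 - (d + 1)\<close> to exhibit the eigenvalue 1 along \<open>?v\<close>.\<close>
  have SIC_eq: "\<Phi>_SIC = scalar_plus_rank_one (?d + 1) (1 - (?d + 1)) ?v"
    using assms(1,2) by (simp add: born_matrix_SIC_eq)
  have det_SIC: "det \<Phi>_SIC = ?c"
    by (simp add: SIC_eq det_scalar_plus_rank_one[OF v])
  have inv: "A ** \<Phi> = mat 1" "\<Phi> ** A = mat 1"
    using outcome_matrix_born_matrix[OF assms(3)] by (simp_all add: A_def assms(4))
  have "\<bar>det A\<bar> * \<bar>det \<Phi>\<bar> = 1"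
    using arg_cong[OF inv(1), of det] by (simp add: det_mul abs_mult[symmetric])
  then have pos: "\<bar>det \<Phi>\<bar> > 0" and detA: "\<bar>det A\<bar> = 1 / \<bar>det \<Phi>\<bar>"
    by (auto simp: eq_divide_eq simp del: abs_mult)
  have ge: "det \<Phi>_SIC \<le> \<bar>det \<Phi>\<bar>"
    using det_outcome_matrix_bound(1)[OF assms(3)] pos
    by (simp add: A_def[symmetric] detA det_SIC)
  have eq: "SIC H \<and> SIC_states \<sigma>" if "\<bar>det \<Phi>\<bar> = det \<Phi>_SIC"
    using det_outcome_matrix_bound(2)[OF assms(3)] pos that
    by (simp add: A_def[symmetric] detA det_SIC)
  \<comment> \<open>The two products on the left are left inverses of
    \<open>A ** transpose A\<close> and \<open>transpose A ** A\<close>. Both of these equal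
    \<open>B ** B\<close>, whose inverse is \<open>\<Phi>_SIC ** \<Phi>_SIC\<close>.\<close>
  have normal: "transpose \<Phi> ** \<Phi> = \<Phi>_SIC ** \<Phi>_SIC" "\<Phi> ** transpose \<Phi> = \<Phi>_SIC ** \<Phi>_SIC"
    if "SIC H \<and> SIC_states \<sigma>"
  proof -
    define B where "B = scalar_plus_rank_one (1 / (?d + 1)) (?d / (?d + 1)) ?v"
    have B: "A ** transpose A = B ** B" "transpose A ** A = B ** B"
      using SIC_outcome_matrix_normal[of H \<sigma>] that by (simp_all add: A_def B_def)
    have BF: "B ** \<Phi>_SIC = mat 1"
      by (simp add: B_def SIC_eq scalar_plus_rank_one_mult[OF v] divide_simps)
        (simp add: scalar_plus_rank_one_1_0)
    have "B ** B ** (\<Phi>_SIC ** \<Phi>_SIC) = B ** (B ** \<Phi>_SIC) ** \<Phi>_SIC"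
      by (simp only: matrix_mul_assoc)
    then have BB: "B ** B ** (\<Phi>_SIC ** \<Phi>_SIC) = mat 1" by (simp add: BF)
    have left_inverse_eq: "X = \<Phi>_SIC ** \<Phi>_SIC" if "X ** (B ** B) = mat 1" for X
    proof -
      have "X = X ** ((B ** B) ** (\<Phi>_SIC ** \<Phi>_SIC))" by (simp add: BB)
      also have "\<dots> = (X ** (B ** B)) ** (\<Phi>_SIC ** \<Phi>_SIC)" by (simp only: matrix_mul_assoc)
      finally show ?thesis by (simp add: that)
    qed
    have "transpose \<Phi> ** \<Phi> ** (A ** transpose A) = transpose \<Phi> ** (\<Phi> ** A) ** transpose A"
      by (simp only: matrix_mul_assoc)
    also have "\<dots> = transpose (A ** \<Phi>)" by (simp add: inv(2) matrix_transpose_mul)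
    finally show "transpose \<Phi> ** \<Phi> = \<Phi>_SIC ** \<Phi>_SIC"
      by (intro left_inverse_eq) (simp add: B(1) inv(1))
    have "\<Phi> ** transpose \<Phi> ** (transpose A ** A) = \<Phi> ** transpose (A ** \<Phi>) ** A"
      by (simp only: matrix_mul_assoc matrix_transpose_mul)
    then show "\<Phi> ** transpose \<Phi> = \<Phi>_SIC ** \<Phi>_SIC"
      by (intro left_inverse_eq) (simp add: B(2) inv)
  qed
  \<comment> \<open>Singular values depend only on \<open>transpose \<Phi> ** \<Phi>\<close>, and
    \<open>\<Phi>_SIC\<close> is symmetric.\<close>
  have sv_eq: "singular_values \<Phi> = singular_values \<Phi>_SIC" if "SIC H \<and> SIC_states \<sigma>"
  proof -
    have "transpose \<Phi>_SIC = \<Phi>_SIC" by (simp add: SIC_eq)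
    then show ?thesis by (simp add: singular_values_def normal(1)[OF that])
  qed
  have abs_SIC: "\<bar>det \<Phi>_SIC\<bar> = det \<Phi>_SIC" by (simp add: det_SIC)
  \<comment> \<open>Equal singular values have equal products, which reduces this equality case to
    that of the determinants.\<close>
  have det_eq: "\<bar>det \<Phi>\<bar> = det \<Phi>_SIC" if "singular_values \<Phi> = singular_values \<Phi>_SIC"
    using arg_cong[OF that, of prod_list] by (simp add: prod_singular_values abs_SIC)
  have small: "\<exists>s\<in>set (singular_values \<Phi>). s \<le> 1"
  proof (rule ex_singular_value_le_1)
    \<comment> \<open>The preimage of the all-ones vector under \<open>\<Phi>\<close>. Since the
      columns of \<open>\<Phi>\<close> sum to 1, \<open>1 \<bullet> ?x = 1 \<bullet> 1\<close>, so
      by Cauchy-Schwarz \<open>?x\<close> is at least as long as its image.\<close>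
    let ?x = "A *v 1"
    have col: "(\<Sum>i\<in>UNIV. \<Phi> $ i $ j) = 1" for j
      using column_quasistochastic_born_matrix[OF assms(3)] by (simp add: column_quasistochastic_def assms(4))
    have \<Phi>x: "\<Phi> *v ?x = 1" by (simp add: matrix_vector_mul_assoc inv(2))
    show "?x \<noteq> 0"
    proof
      assume "?x = 0"
      then have "(1 :: real^'m) = 0" using \<Phi>x by (simp add: matrix_vector_mult_0_right)
      then show False by simp
    qed
    have "(1 :: real^'m) \<bullet> (\<Phi> *v ?x) = 1 \<bullet> ?x"
    proof -
      have "1 v* \<Phi> = 1" by (simp add: vec_eq_iff vector_matrix_mult_def col)
      then show ?thesis by (metis dot_lmul_matrix)
    qed
    then have "(norm (1 :: real^'m))\<^sup>2 = 1 \<bullet> ?x" by (simp add: \<Phi>x power2_norm_eq_inner)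
    also have "\<dots> \<le> norm (1 :: real^'m) * norm ?x" by (rule norm_cauchy_schwarz)
    finally have "norm (1 :: real^'m) \<le> norm ?x" by (simp add: power2_eq_square)
    then show "norm (\<Phi> *v ?x) \<le> norm ?x" by (simp only: \<Phi>x)
  qed
  have "singular_values \<Phi>_SIC = replicate (CARD('m) - 1) (?d + 1) @ [1]"
    unfolding SIC_eq by (rule singular_values_scalar_plus_rank_one[OF v]) simp
  moreover have "weakly_log_majorizes (singular_values \<Phi>) (replicate (CARD('m) - 1) (?d + 1) @ [1])"
    using ge small by (intro weakly_log_majorizes_replicate)
      (simp_all add: decreasing_singular_values singular_values_nonneg length_singular_values
        prod_singular_values det_SIC)
  ultimately have "weakly_log_majorizes (singular_values \<Phi>) (singular_values \<Phi>_SIC)" by simp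
  then show ?thesis using ge eq normal sv_eq det_eq
    using abs_SIC prod_singular_values by metis
qed

end
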